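(* For all fixed integers $r\geq 3$ and $l\geq 5$ with $l$ odd, there exists a constant $c_{r,l}>0$ such that for all $n$, $$R(C_l^r,K_n^r)\leq c_{r,l}\, n^{1+1/\lfloor l/2\rfloor}.$$
   Context: A loose cycle of length $l$ is a hypergraph with $l$ edges $e_1,\dots,e_l$ such that $|e_i\cap e_j|=1$ whenever $j\equiv i+1$ or $j\equiv i-1 \pmod l$, and $e_i\cap e_j=\emptyset$ otherwise. $C_l^r$ denotes an $r$-uniform loose cycle of length $l$ (all edges have size $r$), and $K_n^r$ denotes the complete $r$-uniform hypergraph on $n$ vertices. The Ramsey number $R(C_l^r,K_n^r)$ is the least integer $N$ such that every red/blue colouring of the edges of $K_N^r$ contains a red copy of $C_l^r$ or a blue copy of $K_n^r$. *)

theory Defs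
  imports Complex_Main "HOL-Library.Ramsey" "HOL-Number_Theory.Cong"
begin

text \<open>A hypergraph is given by its set of edges. The edges of the complete r-uniform hypergraph
  on a vertex set \<^term>\<open>V\<close> are \<^term>\<open>nsets V r\<close>, the r-element subsets of \<^term>\<open>V\<close>.\<close>

text \<open>Edges are indexed by \<open>0, \<dots>, l - 1\<close>; the condition \<open>j \<equiv> i - 1\<close> is written \<open>i \<equiv> j + 1\<close>
  to avoid truncated subtraction.\<close>

definition loose_cycle :: "nat \<Rightarrow> 'a set set \<Rightarrow> bool" where
  "loose_cycle l C \<longleftrightarrow>
    (\<exists>e :: nat \<Rightarrow> 'a set. bij_betw e {..<l} C \<and>
      (\<forall>i<l. \<forall>j<l. i \<noteq> j \<longrightarrow>
        (if [j = i + 1] (mod l) \<or> [i = j + 1] (mod l)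
         then card (e i \<inter> e j) = 1
         else e i \<inter> e j = {})))"

definition uniform_loose_cycle :: "nat \<Rightarrow> nat \<Rightarrow> 'a set set \<Rightarrow> bool" where
  "uniform_loose_cycle r l C \<longleftrightarrow> loose_cycle l C \<and> (\<forall>e\<in>C. finite e \<and> card e = r)"

datatype colour = Red | Blue

text \<open>Only the values of \<^term>\<open>f\<close> on \<^term>\<open>nsets {..<N} r\<close> matter below.\<close>

definition has_red_cycle :: "nat \<Rightarrow> nat \<Rightarrow> nat \<Rightarrow> (nat set \<Rightarrow> colour) \<Rightarrow> bool" where
  "has_red_cycle r l N f \<longleftrightarrow>
    (\<exists>C. C \<subseteq> nsets {..<N} r \<and> uniform_loose_cycle r l C \<and> (\<forall>e\<in>C. f e = Red))"

definition has_blue_complete :: "nat \<Rightarrow> nat \<Rightarrow> nat \<Rightarrow> (nat set \<Rightarrow> colour) \<Rightarrow> bool" where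
  "has_blue_complete r n N f \<longleftrightarrow>
    (\<exists>S. S \<subseteq> {..<N} \<and> card S = n \<and> (\<forall>e\<in>nsets S r. f e = Blue))"

definition ramsey_cycle_complete :: "nat \<Rightarrow> nat \<Rightarrow> nat \<Rightarrow> nat" where
  "ramsey_cycle_complete r l n =
    (LEAST N. \<forall>f. has_red_cycle r l N f \<or> has_blue_complete r n N f)"

end

theory Submission imports Defs begin

text \<open>
  Let \<open>l = 2k + 1\<close>. Repeatedly adding to the red hypergraph every set of size at least two that is the
  kernel of a large sunflower, and keeping only the minimal sets, gives a hypergraph with edge sizes
  between \<open>2\<close> and \<open>r\<close> and bounded codegrees. Its independent sets are independent in the red
  hypergraph, and its loose cycles expand to red \<open>r\<close>-uniform ones through free petals.

  In such a sparse hypergraph without a loose \<open>l\<close>-cycle, a breadth-first tree is grown from a vertex,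
  at each step keeping a constant fraction of the new vertices so that any two branches meet in a
  controlled way. For levels \<open>i \<le> k\<close>, many edges inside level \<open>i\<close> would give a loose path of odd length
  \<open>2(k - h) + 1\<close> whose ends lie on branches meeting at height \<open>h\<close>, hence a loose \<open>l\<close>-cycle; so each level
  contains an independent set of linear size. If no independent set has size \<open>n\<close>, some level among
  the first \<open>k\<close> expands by a factor of only \<open>O(n\<^sup>1\<^sup>/\<^sup>k)\<close>. Putting its independent set
  aside, deleting its neighbourhood and iterating yields an independent set of size
  \<open>\<Omega>(N / n\<^sup>1\<^sup>/\<^sup>k)\<close>.
\<close>

section \<open>Greedy selection and averaging\<close>

text \<open>Random choices take the form of \<open>exists_good_colouring\<close>: if every object
  prescribes boundedly many colours, one colouring suits a constant fraction of the objects.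

  The obstacle inside a level is that the ends of a path are known only once the path is built, so
  how their branches meet must be arranged beforehand. Two labels on the leaves do this:
  \<open>c\<close> alternates along a path and \<open>\<omega>\<close> is constant. The ends of an
  odd path then have branches that share the vertex \<open>\<omega>\<close> at level
  \<open>m\<close> and are disjoint beyond it. This is where odd cycle length enters: with
  \<open>h\<close> tree edges on either side, \<open>2 * k + 1 - 2 * h\<close> path edges close the
  cycle, an odd number.

  The exponent comes from \<open>k\<close> successive expansions: if each multiplies the level size
  by at least a constant times \<open>q\<close>, then level \<open>k\<close> has size at least a
  constant times \<open>q ^ k\<close>, so \<open>q\<close> of order \<open>n\<close> to the power
  \<open>1 / k\<close> already forces \<open>n\<close> independent vertices there.\<close>

lemma greedy_independent:
  fixes R :: "'a \<Rightarrow> 'a \<Rightarrow> bool"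
  assumes "finite X"
    and "\<And>Y. Y \<subseteq> X \<Longrightarrow> Y \<noteq> {} \<Longrightarrow> \<exists>y\<in>Y. card {z\<in>Y. z \<noteq> y \<and> (R y z \<or> R z y)} \<le> t"
  shows "\<exists>I\<subseteq>X. (\<forall>x\<in>I. \<forall>y\<in>I. x \<noteq> y \<longrightarrow> \<not> R x y) \<and> card X \<le> (t + 1) * card I"
  using assms
proof (induction "card X" arbitrary: X rule: less_induct)
  case less
  show ?case
  proof (cases "X = {}")
    case False
    then obtain y where y: "y \<in> X" "card {z\<in>X. z \<noteq> y \<and> (R y z \<or> R z y)} \<le> t"
      using less.prems(2)[of X] by auto
    define B where "B = {z\<in>X. z \<noteq> y \<and> (R y z \<or> R z y)}"
    define X' where "X' = X - insert y B"
    have fin: "finite B" "finite X'" using less.prems(1) by (auto simp: B_def X'_def)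
    have "card X' < card X"
      using y less.prems(1) by (intro psubset_card_mono) (auto simp: X'_def)
    moreover have "\<exists>y\<in>Y. card {z\<in>Y. z \<noteq> y \<and> (R y z \<or> R z y)} \<le> t"
      if "Y \<subseteq> X'" "Y \<noteq> {}" for Y
      using less.prems(2)[of Y] that by (auto simp: X'_def)
    ultimately obtain I where I: "I \<subseteq> X'" "\<forall>x\<in>I. \<forall>y\<in>I. x \<noteq> y \<longrightarrow> \<not> R x y"
      "card X' \<le> (t + 1) * card I"
      using less.hyps[of X'] fin by blast
    have "y \<notin> I" "finite I" using I(1) fin finite_subset by (auto simp: X'_def)
    have "X = X' \<union> insert y B" using y by (auto simp: X'_def B_def)
    then have "card X \<le> card X' + card (insert y B)" by (metis card_Un_le)
    also have "card (insert y B) \<le> t + 1"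
      using y(2) fin by (simp add: B_def card_insert_if)
    finally have "card X \<le> (t + 1) * card (insert y I)"
      using I(3) \<open>y \<notin> I\<close> \<open>finite I\<close> by simp
    moreover have "\<forall>a\<in>insert y I. \<forall>b\<in>insert y I. a \<noteq> b \<longrightarrow> \<not> R a b"
      using I(1,2) by (auto simp: X'_def B_def)
    moreover have "insert y I \<subseteq> X" using I(1) y(1) by (auto simp: X'_def)
    ultimately show ?thesis by blast
  qed auto
qed

lemma sum_card_swap:
  assumes "finite X" "finite Y"
  shows "(\<Sum>x\<in>X. card {y\<in>Y. R x y}) = (\<Sum>y\<in>Y. card {x\<in>X. R x y})"
proof -
  have "(\<Sum>x\<in>X. card {y\<in>Y. R x y}) = (\<Sum>x\<in>X. \<Sum>y\<in>Y. if R x y then 1 else 0)"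
    using assms by (intro sum.cong) (auto simp: sum.If_cases Int_def)
  also have "\<dots> = (\<Sum>y\<in>Y. \<Sum>x\<in>X. if R x y then 1 else 0)" by (rule sum.swap)
  also have "\<dots> = (\<Sum>y\<in>Y. card {x\<in>X. R x y})"
    using assms by (intro sum.cong) (auto simp: sum.If_cases Int_def)
  finally show ?thesis .
qed

lemma exists_le_average:
  fixes h :: "'a \<Rightarrow> nat"
  assumes "finite Y" "Y \<noteq> {}" "(\<Sum>y\<in>Y. h y) \<le> t * card Y"
  shows "\<exists>y\<in>Y. h y \<le> t"
proof (rule ccontr)
  assume "\<not> ?thesis"
  then have "(\<Sum>y\<in>Y. t) < (\<Sum>y\<in>Y. h y)"
    using assms by (intro sum_strict_mono) auto
  then show False using assms by (simp add: mult.commute)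
qed

text \<open>Within any subset the indegrees have the same sum as the outdegrees, so some vertex has
  indegree at most \<open>t\<close> and total degree at most \<open>2 * t\<close>; greedy selection
  needs no more.\<close>

lemma bounded_outdegree_independent:
  fixes R :: "'a \<Rightarrow> 'a \<Rightarrow> bool"
  assumes "finite X" and out: "\<And>x. x \<in> X \<Longrightarrow> card {y\<in>X. R x y} \<le> t"
  shows "\<exists>I\<subseteq>X. (\<forall>x\<in>I. \<forall>y\<in>I. x \<noteq> y \<longrightarrow> \<not> R x y) \<and> card X \<le> (2 * t + 1) * card I"
proof (rule greedy_independent[OF assms(1)])
  fix Y assume Y: "Y \<subseteq> X" "Y \<noteq> {}"
  then have fin: "finite Y" using assms(1) finite_subset by blast
  have o: "card {z\<in>Y. R y z} \<le> t" if "y \<in> Y" for y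
    using out[of y] that Y card_mono[of "{z\<in>X. R y z}" "{z\<in>Y. R y z}"] assms(1) by fastforce
  have "(\<Sum>y\<in>Y. card {z\<in>Y. R z y}) = (\<Sum>y\<in>Y. card {z\<in>Y. R y z})"
    using sum_card_swap[OF fin fin, of R] by simp
  also have "\<dots> \<le> (\<Sum>y\<in>Y. t)" using o by (rule sum_mono)
  finally obtain y where y: "y \<in> Y" "card {z\<in>Y. R z y} \<le> t"
    using exists_le_average[OF fin Y(2), of "\<lambda>y. card {z\<in>Y. R z y}" t] by (auto simp: mult.commute)
  have "card {z\<in>Y. z \<noteq> y \<and> (R y z \<or> R z y)} \<le> card ({z\<in>Y. R y z} \<union> {z\<in>Y. R z y})"
    using fin by (intro card_mono) auto
  also have "\<dots> \<le> card {z\<in>Y. R y z} + card {z\<in>Y. R z y}" by (rule card_Un_le)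
  also have "\<dots> \<le> 2 * t" using y o[of y] by simp
  finally show "\<exists>y\<in>Y. card {z\<in>Y. z \<noteq> y \<and> (R y z \<or> R z y)} \<le> 2 * t" using y by blast
qed

text \<open>Method of conditional expectations. If each \<open>s\<close> is coloured uniformly from
  \<open>K s\<close>, the left side bounds the expected number of satisfied \<open>f\<close> from
  below. The weights depend on \<open>card (Dm f)\<close> because domains shrink as points of
  \<open>S\<close> are coloured.\<close>

lemma weighted_colouring:
  fixes \<sigma> :: "'f \<Rightarrow> 's \<Rightarrow> 'c" and q :: nat
  assumes "finite S" "finite A" "\<And>f. f \<in> A \<Longrightarrow> Dm f \<subseteq> S"
    and "\<And>s. s \<in> S \<Longrightarrow> finite (K s) \<and> card (K s) \<le> q"
    and "\<And>f s. f \<in> A \<Longrightarrow> s \<in> Dm f \<Longrightarrow> \<sigma> f s \<in> K s"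
  shows "\<exists>g. (\<Sum>f\<in>A. (1 / real q) ^ card (Dm f)) \<le> card {f\<in>A. \<forall>s\<in>Dm f. g s = \<sigma> f s}"
  using assms
proof (induction S arbitrary: A Dm rule: finite_induct)
  case empty
  then have "\<forall>f\<in>A. Dm f = {}" by blast
  then have "{f\<in>A. \<forall>s\<in>Dm f. g s = \<sigma> f s} = A" for g by auto
  then show ?case using \<open>\<forall>f\<in>A. Dm f = {}\<close> by simp
next
  case (insert s S)
  define w where "w f = (1 / real q) ^ card (Dm f)" for f
  define Dm' where "Dm' f = Dm f - {s}" for f
  define w' where "w' f = (1 / real q) ^ card (Dm' f)" for f
  define A' where "A' c = {f\<in>A. s \<in> Dm f \<longrightarrow> \<sigma> f s = c}" for c
  have Ks: "finite (K s)" "card (K s) \<le> q" using insert.prems by auto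
  have finA: "finite (A' c)" for c using insert.prems by (simp add: A'_def)
  have finD: "finite (Dm f)" if "f \<in> A" for f
    using insert.prems(2)[OF that] insert.hyps(1) finite_subset by blast
  have IH: "\<exists>g. (\<Sum>f\<in>A' c. w' f) \<le> card {f\<in>A' c. \<forall>s\<in>Dm' f. g s = \<sigma> f s}" for c
    unfolding w'_def using insert.prems finA
    by (intro insert.IH) (auto simp: Dm'_def A'_def)
  show ?case
  proof (cases "\<exists>f\<in>A. s \<in> Dm f")
    case False
    then have "A' c = A" "\<And>f. f \<in> A \<Longrightarrow> Dm' f = Dm f" for c
      by (auto simp: A'_def Dm'_def)
    \<comment> \<open>No \<open>f\<close> constrains \<open>s\<close>, so every colour leaves the
      same family and an arbitrary one will do.\<close>
    then show ?thesis using IH[of undefined]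
      by (simp add: w'_def cong: conj_cong)
  next
    case True
    then have Kne: "K s \<noteq> {}" using insert.prems(4) by blast
    then have q: "q > 0" using Ks by (metis card_gt_0_iff le_eq_less_or_eq less_trans)
    \<comment> \<open>Averaging over the colours of \<open>s\<close>: an \<open>f\<close> that
      constrains \<open>s\<close> survives for one colour with its weight multiplied by
      \<open>q\<close>, any other \<open>f\<close> survives for all \<open>card (K s)\<close>
      colours with its weight unchanged.\<close>
    have "\<exists>c\<in>K s. (\<Sum>f\<in>A. w f) \<le> (\<Sum>f\<in>A' c. w' f)"
    proof (rule ccontr)
      assume "\<not> ?thesis"
      then have "(\<Sum>c\<in>K s. \<Sum>f\<in>A' c. w' f) < (\<Sum>c\<in>K s. \<Sum>f\<in>A. w f)"
        using Ks Kne by (intro sum_strict_mono) auto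
      also have "\<dots> = (\<Sum>f\<in>A. card (K s) * w f)" by (simp add: sum_distrib_left)
      also have "\<dots> \<le> (\<Sum>f\<in>A. \<Sum>c\<in>K s. if s \<in> Dm f \<longrightarrow> \<sigma> f s = c then w' f else 0)"
      proof (rule sum_mono)
        fix f assume f: "f \<in> A"
        show "card (K s) * w f \<le> (\<Sum>c\<in>K s. if s \<in> Dm f \<longrightarrow> \<sigma> f s = c then w' f else 0)"
        proof (cases "s \<in> Dm f")
          case True
          then have "card (Dm f) = Suc (card (Dm' f))"
            using finD[OF f] unfolding Dm'_def by (metis card.remove)
          then have "q * w f = w' f" using q by (simp add: w_def w'_def)
          moreover have "(\<Sum>c\<in>K s. if s \<in> Dm f \<longrightarrow> \<sigma> f s = c then w' f else 0) = w' f"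
            using True insert.prems(4)[OF f True] Ks by (simp add: sum.delta)
          moreover have "card (K s) * w f \<le> q * w f"
            using Ks by (intro mult_right_mono) (auto simp: w_def)
          ultimately show ?thesis by linarith
        next
          case False
          then have "w' f = w f" by (simp add: w_def w'_def Dm'_def)
          then show ?thesis using False by simp
        qed
      qed
      also have "\<dots> = (\<Sum>c\<in>K s. \<Sum>f\<in>A. if s \<in> Dm f \<longrightarrow> \<sigma> f s = c then w' f else 0)"
        by (rule sum.swap)
      also have "\<dots> = (\<Sum>c\<in>K s. \<Sum>f\<in>A' c. w' f)"
        unfolding A'_def using insert.prems(1) by (simp only: sum.inter_filter)
      finally show False by simp
    qed
    then obtain c where c: "c \<in> K s" "(\<Sum>f\<in>A. w f) \<le> (\<Sum>f\<in>A' c. w' f)" by blast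
    obtain g where g: "(\<Sum>f\<in>A' c. w' f) \<le> card {f\<in>A' c. \<forall>s\<in>Dm' f. g s = \<sigma> f s}"
      using IH by blast
    have "card {f\<in>A' c. \<forall>s\<in>Dm' f. g s = \<sigma> f s} \<le> card {f\<in>A. \<forall>u\<in>Dm f. (g(s := c)) u = \<sigma> f u}"
      using insert.prems(1) by (intro card_mono) (auto simp: A'_def Dm'_def)
    then show ?thesis using c(2) g unfolding w_def
      by (intro exI[of _ "g(s := c)"]) linarith
  qed
qed

text \<open>The form in which random colouring is used below. Letting the palette \<open>K s\<close>
  vary with \<open>s\<close> allows a leaf to be coloured by a vertex of its own branch.\<close>

lemma exists_good_colouring:
  fixes \<sigma> :: "'f \<Rightarrow> 's \<Rightarrow> 'c" and q t :: nat
  assumes "finite A" "\<And>f. f \<in> A \<Longrightarrow> finite (Dm f) \<and> card (Dm f) \<le> t"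
    and "\<And>f s. f \<in> A \<Longrightarrow> s \<in> Dm f \<Longrightarrow> \<sigma> f s \<in> K s"
    and K: "\<And>f s. f \<in> A \<Longrightarrow> s \<in> Dm f \<Longrightarrow> finite (K s) \<and> card (K s) \<le> q" and "q > 0"
  shows "\<exists>g. card A \<le> q ^ t * card {f\<in>A. \<forall>s\<in>Dm f. g s = \<sigma> f s}"
proof -
  have "\<exists>g. (\<Sum>f\<in>A. (1 / real q) ^ card (Dm f)) \<le> card {f\<in>A. \<forall>s\<in>Dm f. g s = \<sigma> f s}"
    using assms by (intro weighted_colouring[where S = "\<Union>(Dm ` A)" and K = K]) auto
  then obtain g where g: "(\<Sum>f\<in>A. (1 / real q) ^ card (Dm f)) \<le> card {f\<in>A. \<forall>s\<in>Dm f. g s = \<sigma> f s}" ..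
  have "(\<Sum>f\<in>A. (1 / real q) ^ t) \<le> (\<Sum>f\<in>A. (1 / real q) ^ card (Dm f))"
    using assms by (intro sum_mono power_decreasing) auto
  then have "real (card A) * (1 / real q) ^ t \<le> card {f\<in>A. \<forall>s\<in>Dm f. g s = \<sigma> f s}"
    using g by simp
  then have "real (card A) \<le> real (q ^ t * card {f\<in>A. \<forall>s\<in>Dm f. g s = \<sigma> f s})"
    using \<open>q > 0\<close> by (simp add: field_simps power_divide)
  then show ?thesis unfolding of_nat_le_iff by blast
qed

text \<open>Passing to a subgraph of large minimum degree, for the multigraph with an edge from
  \<open>a f\<close> to \<open>b f\<close>: removing a vertex of degree at most \<open>d\<close>
  preserves \<open>card F > d * card Y\<close>. Different \<open>f\<close> may have the same ends,
  hence a family rather than a set of pairs.\<close>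

lemma min_degree_subfamily:
  fixes a b :: "'f \<Rightarrow> 'a"
  assumes "finite Y" "finite F" "\<And>f. f \<in> F \<Longrightarrow> a f \<in> Y \<and> b f \<in> Y" "card F > d * card Y"
  shows "\<exists>F'\<subseteq>F. F' \<noteq> {} \<and> (\<forall>f\<in>F'. \<forall>z\<in>{a f, b f}. card {g\<in>F'. z = a g \<or> z = b g} > d)"
  using assms
proof (induction "card Y" arbitrary: Y F rule: less_induct)
  case less
  show ?case
  proof (cases "\<forall>z\<in>Y. card {g\<in>F. z = a g \<or> z = b g} > d")
    case True
    have "F \<noteq> {}" using less.prems(4) by auto
    with True show ?thesis using less.prems(3) by (intro exI[of _ F]) auto
  next
    case False
    then obtain z where z: "z \<in> Y" "card {g\<in>F. z = a g \<or> z = b g} \<le> d" by force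
    define G where "G = {g\<in>F. z = a g \<or> z = b g}"
    have "finite G" "G \<subseteq> F" using less.prems(2) by (auto simp: G_def)
    have Y: "card Y = Suc (card (Y - {z}))" using z less.prems(1) by (metis card.remove)
    have "card (F - G) = card F - card G"
      using \<open>finite G\<close> \<open>G \<subseteq> F\<close> by (rule card_Diff_subset)
    then have "card (F - G) > d * card (Y - {z})"
      using less.prems(4) z(2) unfolding G_def[symmetric] Y by simp
    moreover have "card (Y - {z}) < card Y" using Y by simp
    moreover have "a f \<in> Y - {z} \<and> b f \<in> Y - {z}" if "f \<in> F - G" for f
      using that less.prems(3)[of f] by (auto simp: G_def)
    ultimately have "\<exists>F'\<subseteq>F - G. F' \<noteq> {} \<and>
        (\<forall>f\<in>F'. \<forall>z\<in>{a f, b f}. card {g\<in>F'. z = a g \<or> z = b g} > d)"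
      using less.prems(1,2) by (intro less.hyps) auto
    then show ?thesis by (meson Diff_subset order_trans)
  qed
qed

section \<open>Loose cycles and sparse hypergraphs\<close>

text \<open>Constraining only \<open>a < b\<close> and writing disjointness as cardinality 0 lets
  one formula cover all cases. Edge sizes are left free because cycles are first found in a
  non-uniform hypergraph.\<close>

definition cyclic_edges :: "nat \<Rightarrow> (nat \<Rightarrow> 'a set) \<Rightarrow> bool" where
  "cyclic_edges l e \<longleftrightarrow> (\<forall>a b. a < b \<and> b < l \<longrightarrow>
     card (e a \<inter> e b) = (if b = Suc a \<or> (a = 0 \<and> b = l - 1) then 1 else 0))"

lemma cong_Suc_mod_iff:
  fixes i j l :: nat
  assumes "i < l" "j < l"
  shows "[j = i + 1] (mod l) \<longleftrightarrow> j = Suc i \<or> (i = l - 1 \<and> j = 0)"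
proof (cases "Suc i < l")
  case True
  then show ?thesis using assms by (auto simp: cong_def)
next
  case False
  then have "Suc i = l" using assms by simp
  then show ?thesis using assms by (auto simp: cong_def)
qed

text \<open>Distinct indices carry distinct edges because intersections have at most one vertex
  while edges have at least two.\<close>

lemma cyclic_edges_imp_loose_cycle:
  assumes cyc: "cyclic_edges l e" and "l \<ge> 3"
    and size: "\<And>a. a < l \<Longrightarrow> finite (e a) \<and> card (e a) \<ge> 2"
  shows "loose_cycle l (e ` {..<l})"
  unfolding loose_cycle_def
proof (intro exI[of _ e] conjI allI impI)
  have ne: "e a \<noteq> e b" if "a < b" "b < l" for a b
  proof
    assume "e a = e b"
    then have "card (e a \<inter> e b) \<ge> 2" using size[of b] that by simp
    moreover have "card (e a \<inter> e b) \<le> 1" using cyc that by (simp add: cyclic_edges_def)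
    ultimately show False by simp
  qed
  have "inj_on e {..<l}"
  proof (rule inj_onI)
    fix a b assume "a \<in> {..<l}" "b \<in> {..<l}" "e a = e b"
    then show "a = b" using ne[of a b] ne[of b a] by (metis lessThan_iff nat_neq_iff)
  qed
  then show "bij_betw e {..<l} (e ` {..<l})" by (rule inj_on_imp_bij_betw)
next
  fix i j assume ij: "i < l" "j < l" "i \<noteq> j"
  have *: "if b = Suc a \<or> (a = 0 \<and> b = l - 1) then card (e a \<inter> e b) = 1 else e a \<inter> e b = {}"
    if "a < b" "b < l" for a b
  proof -
    have "card (e a \<inter> e b) = (if b = Suc a \<or> (a = 0 \<and> b = l - 1) then 1 else 0)"
      using cyc that unfolding cyclic_edges_def by blast
    moreover have "finite (e a \<inter> e b)" using size[of a] that by simp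
    ultimately show ?thesis by auto
  qed
  show "if [j = i + 1] (mod l) \<or> [i = j + 1] (mod l) then card (e i \<inter> e j) = 1 else e i \<inter> e j = {}"
  proof (cases "i < j")
    case True
    then have "[j = i + 1] (mod l) \<or> [i = j + 1] (mod l) \<longleftrightarrow> j = Suc i \<or> (i = 0 \<and> j = l - 1)"
      unfolding cong_Suc_mod_iff[OF ij(1,2)] cong_Suc_mod_iff[OF ij(2,1)] by auto
    then show ?thesis using *[OF True ij(2)] by (simp only:)
  next
    case False
    then have "j < i" using ij by simp
    then have "[j = i + 1] (mod l) \<or> [i = j + 1] (mod l) \<longleftrightarrow> i = Suc j \<or> (j = 0 \<and> i = l - 1)"
      unfolding cong_Suc_mod_iff[OF ij(1,2)] cong_Suc_mod_iff[OF ij(2,1)] by auto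
    then show ?thesis using *[OF \<open>j < i\<close> ij(1)] by (simp only: Int_commute)
  qed
qed

section \<open>Independence, neighbourhoods and bounded codegree\<close>

definition independent :: "'a set set \<Rightarrow> 'a set \<Rightarrow> bool" where
  "independent H I \<longleftrightarrow> (\<forall>e\<in>H. \<not> e \<subseteq> I)"

text \<open>Only edges inside \<open>W\<close> count: \<open>W\<close> is what remains after earlier
  neighbourhoods have been deleted.\<close>

definition nbhd :: "'a set set \<Rightarrow> 'a set \<Rightarrow> 'a set \<Rightarrow> 'a set" where
  "nbhd H W S = S \<union> \<Union>{e\<in>H. e \<subseteq> W \<and> e \<inter> S \<noteq> {}}"

locale sparse_hypergraph =
  fixes H :: "'a set set" and r D :: nat
  assumes finite_edges: "finite H"
    and edge_finite: "e \<in> H \<Longrightarrow> finite e"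
    and edge_card_ge: "e \<in> H \<Longrightarrow> 2 \<le> card e"
    and edge_card_le: "e \<in> H \<Longrightarrow> card e \<le> r"
    and codegree: "u \<noteq> v \<Longrightarrow> card {e\<in>H. u \<in> e \<and> v \<in> e} \<le> D"
begin

lemma card_edges_through_le:
  assumes "finite A"
  shows "card {e\<in>H. z \<in> e \<and> \<not> e \<inter> A \<subseteq> {z}} \<le> card A * D"
proof -
  have "{e\<in>H. z \<in> e \<and> \<not> e \<inter> A \<subseteq> {z}} \<subseteq> (\<Union>u\<in>A - {z}. {e\<in>H. u \<in> e \<and> z \<in> e})" by auto
  then have "card {e\<in>H. z \<in> e \<and> \<not> e \<inter> A \<subseteq> {z}} \<le> card (\<Union>u\<in>A - {z}. {e\<in>H. u \<in> e \<and> z \<in> e})"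
    using assms finite_edges by (intro card_mono) auto
  also have "\<dots> \<le> (\<Sum>u\<in>A - {z}. card {e\<in>H. u \<in> e \<and> z \<in> e})"
    using assms by (intro card_UN_le) auto
  also have "\<dots> \<le> (\<Sum>u\<in>A - {z}. D)" by (intro sum_mono codegree) auto
  also have "\<dots> \<le> card A * D" using assms by (simp add: card_Diff1_le)
  finally show ?thesis .
qed

text \<open>The factors are the choice of one common vertex in \<open>A\<close>, at most
  \<open>r * D\<close> edges through it that meet \<open>A\<close> again, and \<open>r\<close>
  vertices per edge.\<close>

lemma card_Union_overlapping_le:
  assumes "finite A" "card A \<le> r"
  shows "card (\<Union>{e\<in>H. card (e \<inter> A) \<ge> 2}) \<le> r * r * D * r"
proof -
  have sub: "{e\<in>H. card (e \<inter> A) \<ge> 2} \<subseteq> (\<Union>z\<in>A. {e\<in>H. z \<in> e \<and> \<not> e \<inter> A \<subseteq> {z}})"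
  proof
    fix e assume e: "e \<in> {e\<in>H. card (e \<inter> A) \<ge> 2}"
    then have "e \<inter> A \<noteq> {}" by auto
    then obtain z where z: "z \<in> e \<inter> A" by blast
    have "\<not> e \<inter> A \<subseteq> {z}"
    proof
      assume "e \<inter> A \<subseteq> {z}"
      then have "card (e \<inter> A) \<le> 1" using card_mono[of "{z}" "e \<inter> A"] by simp
      with e show False by simp
    qed
    with e z show "e \<in> (\<Union>z\<in>A. {e\<in>H. z \<in> e \<and> \<not> e \<inter> A \<subseteq> {z}})" by auto
  qed
  have "card {e\<in>H. card (e \<inter> A) \<ge> 2} \<le> card (\<Union>z\<in>A. {e\<in>H. z \<in> e \<and> \<not> e \<inter> A \<subseteq> {z}})"
    using sub assms finite_edges by (intro card_mono) auto
  also have "\<dots> \<le> (\<Sum>z\<in>A. card {e\<in>H. z \<in> e \<and> \<not> e \<inter> A \<subseteq> {z}})"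
    using assms by (intro card_UN_le) auto
  also have "\<dots> \<le> (\<Sum>z\<in>A. card A * D)"
    using assms by (intro sum_mono card_edges_through_le) auto
  also have "\<dots> \<le> r * (r * D)" using assms by (auto intro!: mult_le_mono)
  finally have c: "card {e\<in>H. card (e \<inter> A) \<ge> 2} \<le> r * (r * D)" .
  have "card (\<Union>{e\<in>H. card (e \<inter> A) \<ge> 2}) \<le> (\<Sum>e\<in>{e\<in>H. card (e \<inter> A) \<ge> 2}. card e)"
    by (rule card_Union_le_sum_card)
  also have "\<dots> \<le> (\<Sum>e\<in>{e\<in>H. card (e \<inter> A) \<ge> 2}. r)"
    using edge_card_le by (intro sum_mono) auto
  also have "\<dots> \<le> r * (r * D) * r" using c by simp
  finally show ?thesis by (simp add: mult_ac)
qed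

text \<open>Greedy extension: the path covers at most \<open>p * r\<close> vertices, so by the
  codegree bound at most \<open>p * r * D\<close> edges through its last vertex meet it elsewhere.
  Each edge is entered at one of \<open>s f\<close>, \<open>t f\<close> and left at the other, which
  makes \<open>c\<close> alternate and keeps \<open>\<omega>\<close> constant.\<close>

lemma exists_loose_path:
  fixes c :: "'a \<Rightarrow> bool" and \<omega> :: "'a \<Rightarrow> 'b" and s t :: "'a set \<Rightarrow> 'a"
  assumes F: "F \<subseteq> H" "F \<noteq> {}"
    and st: "\<And>f. f \<in> F \<Longrightarrow> s f \<in> f \<and> t f \<in> f \<and> c (s f) \<and> \<not> c (t f) \<and> \<omega> (s f) = \<omega> (t f)"
    and deg: "\<And>f z. f \<in> F \<Longrightarrow> z = s f \<or> z = t f \<Longrightarrow> card {g\<in>F. z = s g \<or> z = t g} > p * r * D"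
  shows "\<exists>e v. (\<forall>j<p. e j \<in> F \<and> v j \<in> e j \<and> v (Suc j) \<in> e j \<and> v j \<noteq> v (Suc j)) \<and>
    (\<forall>j j'. j < j' \<and> j' < p \<longrightarrow> e j \<inter> e j' = (if j' = Suc j then {v j'} else {})) \<and>
    (\<forall>j. Suc j < p \<longrightarrow> v p \<notin> e j) \<and>
    (\<exists>f\<in>F. v 0 = s f \<or> v 0 = t f) \<and> (\<exists>f\<in>F. v p = s f \<or> v p = t f) \<and>
    \<omega> (v p) = \<omega> (v 0) \<and> (c (v p) = c (v 0) \<longleftrightarrow> even p)" (is "\<exists>e v. ?P p e v")
  using deg
proof (induction p)
  case 0
  obtain f where "f \<in> F" using F by blast
  then show ?case by (intro exI[of _ "\<lambda>_. {}"] exI[of _ "\<lambda>_. s f"]) auto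
next
  case (Suc p)
  have "card {g\<in>F. z = s g \<or> z = t g} > p * r * D" if "f \<in> F" "z = s f \<or> z = t f" for f z
    using Suc.prems[OF that] by (simp add: algebra_simps)
  then obtain e v where ev0: "?P p e v" using Suc.IH by blast
  then have ev: "\<And>j. j < p \<Longrightarrow> e j \<in> F \<and> v j \<in> e j \<and> v (Suc j) \<in> e j \<and> v j \<noteq> v (Suc j)"
    "\<And>j j'. j < j' \<Longrightarrow> j' < p \<Longrightarrow> e j \<inter> e j' = (if j' = Suc j then {v j'} else {})"
    "\<And>j. Suc j < p \<Longrightarrow> v p \<notin> e j"
    "\<exists>f\<in>F. v 0 = s f \<or> v 0 = t f" "\<exists>f\<in>F. v p = s f \<or> v p = t f"
    "\<omega> (v p) = \<omega> (v 0)" "c (v p) = c (v 0) \<longleftrightarrow> even p"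
    by - (blast | simp)+
  define A where "A = (\<Union>j<p. e j)"
  have eH: "e j \<in> H" if "j < p" for j using ev(1)[OF that] F by blast
  have A: "finite A" using eH edge_finite by (auto simp: A_def)
  have "card A \<le> (\<Sum>j<p. card (e j))" unfolding A_def by (rule card_UN_le) simp
  also have "\<dots> \<le> (\<Sum>j<p. r)" using eH edge_card_le by (intro sum_mono) auto
  also have "\<dots> \<le> Suc p * r" by simp
  finally have cA: "card A * D \<le> Suc p * r * D" by (rule mult_le_mono1)
  have "\<exists>g\<in>{g\<in>F. v p = s g \<or> v p = t g}. g \<notin> {e\<in>H. v p \<in> e \<and> \<not> e \<inter> A \<subseteq> {v p}}"
  proof (rule ccontr)
    assume "\<not> ?thesis"
    then have "{g\<in>F. v p = s g \<or> v p = t g} \<subseteq> {e\<in>H. v p \<in> e \<and> \<not> e \<inter> A \<subseteq> {v p}}" by blast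
    then have "card {g\<in>F. v p = s g \<or> v p = t g} \<le> card {e\<in>H. v p \<in> e \<and> \<not> e \<inter> A \<subseteq> {v p}}"
      using finite_edges by (intro card_mono) auto
    also note card_edges_through_le[OF A, of "v p"]
    also note cA
    finally have "card {g\<in>F. v p = s g \<or> v p = t g} \<le> Suc p * r * D" .
    moreover obtain f where "f \<in> F" "v p = s f \<or> v p = t f" using ev(5) by blast
    ultimately show False using Suc.prems[of f "v p"] by linarith
  qed
  then obtain g where g0: "g \<in> F" "v p = s g \<or> v p = t g" "\<not> (g \<in> H \<and> v p \<in> g \<and> \<not> g \<inter> A \<subseteq> {v p})"
    by auto
  then have g: "g \<in> F" "v p = s g \<or> v p = t g" "v p \<in> g" "g \<inter> A \<subseteq> {v p}"
    using F(1) st[OF g0(1)] by auto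
  \<comment> \<open>The new end is the other chosen vertex of \<open>g\<close>; it differs from
    \<open>v p\<close>, the only vertex that \<open>g\<close> may share with the path.\<close>
  define w where "w = (if v p = s g then t g else s g)"
  have w: "w \<in> g" "w \<noteq> v p" "\<omega> w = \<omega> (v p)" "c w \<longleftrightarrow> \<not> c (v p)" "w = s g \<or> w = t g"
    using st[OF g(1)] g(2) by (auto simp: w_def)
  have wA: "w \<notin> A" using w g(4) by auto
  have ge: "e j \<inter> g = (if p = Suc j then {v p} else {})" if "j < p" for j
  proof -
    have "e j \<inter> g \<subseteq> {v p}" using that g(4) by (auto simp: A_def)
    moreover have "v p \<in> e j \<longleftrightarrow> p = Suc j" using ev(1)[of j] ev(3)[of j] that
      by (metis Suc_lessI)
    ultimately show ?thesis using g(3) by auto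
  qed
  show ?case
  proof (intro exI[of _ "e(p := g)"] exI[of _ "v(Suc p := w)"] conjI)
    show "\<forall>j<Suc p. (e(p := g)) j \<in> F \<and> (v(Suc p := w)) j \<in> (e(p := g)) j \<and>
        (v(Suc p := w)) (Suc j) \<in> (e(p := g)) j \<and> (v(Suc p := w)) j \<noteq> (v(Suc p := w)) (Suc j)"
      using ev(1) g w by (auto simp: less_Suc_eq)
    show "\<forall>j j'. j < j' \<and> j' < Suc p \<longrightarrow> (e(p := g)) j \<inter> (e(p := g)) j' =
        (if j' = Suc j then {(v(Suc p := w)) j'} else {})"
      using ev(2) ge by (auto simp: less_Suc_eq)
    show "\<forall>j. Suc j < Suc p \<longrightarrow> (v(Suc p := w)) (Suc p) \<notin> (e(p := g)) j"
      using wA by (auto simp: A_def)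
    show "\<exists>f\<in>F. (v(Suc p := w)) 0 = s f \<or> (v(Suc p := w)) 0 = t f" using ev(4) by simp
    show "\<exists>f\<in>F. (v(Suc p := w)) (Suc p) = s f \<or> (v(Suc p := w)) (Suc p) = t f" using w g by auto
    show "\<omega> ((v(Suc p := w)) (Suc p)) = \<omega> ((v(Suc p := w)) 0)" using w ev(6) by simp
    show "(c ((v(Suc p := w)) (Suc p)) = c ((v(Suc p := w)) 0)) = even (Suc p)"
      using w ev(7) by auto
  qed
qed

end

section \<open>Loose trees\<close>

text \<open>\<open>S m\<close> is level \<open>m\<close> and \<open>E m x\<close> is the edge between levels \<open>m - 1\<close> and \<open>m\<close> on the branch ending
  in the leaf \<open>x\<close>; only leaves \<open>x \<in> S j\<close> matter. \<open>E 0 x\<close> is the root as a singleton, which is not an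
  edge. Two branches may also meet in vertices that are not tree vertices, but by the last three
  clauses only inside edges of the same level.\<close>

definition loose_tree ::
    "'a set set \<Rightarrow> 'a set \<Rightarrow> nat \<Rightarrow> (nat \<Rightarrow> 'a set) \<Rightarrow> (nat \<Rightarrow> 'a \<Rightarrow> 'a set) \<Rightarrow> bool" where
  "loose_tree H W j S E \<longleftrightarrow>
    card (S 0) = 1 \<and> (\<forall>m\<le>j. S m \<subseteq> W) \<and>
    (\<forall>m m'. m < m' \<and> m' \<le> j \<longrightarrow> S m \<inter> S m' = {}) \<and>
    (\<forall>x\<in>S j. x \<in> E j x \<and> E 0 x = S 0 \<and>
      (\<forall>m<j. E (Suc m) x \<in> H \<and> E (Suc m) x \<subseteq> S m \<union> S (Suc m) \<and>
        card (E m x \<inter> E (Suc m) x) = 1)) \<and>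
    (\<forall>x\<in>S j. \<forall>y\<in>S j. \<forall>m<j.
      (E m x \<inter> E (Suc m) y \<noteq> {} \<longrightarrow> E m x = E m y) \<and>
      (E m x = E m y \<longrightarrow> E (Suc m) x \<inter> E (Suc m) y \<noteq> {}) \<and>
      (E (Suc m) x = E (Suc m) y \<or> card (E (Suc m) x \<inter> E (Suc m) y) \<le> 1))"

lemma loose_treeD:
  assumes "loose_tree H W j S E"
  shows "card (S 0) = 1" "m \<le> j \<Longrightarrow> S m \<subseteq> W" "m < m' \<Longrightarrow> m' \<le> j \<Longrightarrow> S m \<inter> S m' = {}"
    "x \<in> S j \<Longrightarrow> x \<in> E j x" "x \<in> S j \<Longrightarrow> E 0 x = S 0"
    "x \<in> S j \<Longrightarrow> m < j \<Longrightarrow> E (Suc m) x \<in> H"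
    "x \<in> S j \<Longrightarrow> m < j \<Longrightarrow> E (Suc m) x \<subseteq> S m \<union> S (Suc m)"
    "x \<in> S j \<Longrightarrow> m < j \<Longrightarrow> card (E m x \<inter> E (Suc m) x) = 1"
    "x \<in> S j \<Longrightarrow> y \<in> S j \<Longrightarrow> m < j \<Longrightarrow> E m x \<inter> E (Suc m) y \<noteq> {} \<Longrightarrow> E m x = E m y"
    "x \<in> S j \<Longrightarrow> y \<in> S j \<Longrightarrow> m < j \<Longrightarrow> E m x = E m y \<Longrightarrow> E (Suc m) x \<inter> E (Suc m) y \<noteq> {}"
    "x \<in> S j \<Longrightarrow> y \<in> S j \<Longrightarrow> m < j \<Longrightarrow>
      E (Suc m) x = E (Suc m) y \<or> card (E (Suc m) x \<inter> E (Suc m) y) \<le> 1"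
proof -
  note c1 = assms[unfolded loose_tree_def]
  note c2 = conjunct2[OF c1] note c3 = conjunct2[OF c2] note c4 = conjunct2[OF c3]
  note d = conjunct1[OF c4, rule_format] and p = conjunct2[OF c4, rule_format]
  show "card (S 0) = 1" by (rule conjunct1[OF c1])
  show "m \<le> j \<Longrightarrow> S m \<subseteq> W" by (rule conjunct1[OF c2, rule_format])
  show "m < m' \<Longrightarrow> m' \<le> j \<Longrightarrow> S m \<inter> S m' = {}" by (rule conjunct1[OF c3, rule_format]) simp
  show "x \<in> S j \<Longrightarrow> x \<in> E j x" by (drule d) simp
  show "x \<in> S j \<Longrightarrow> E 0 x = S 0" by (drule d) simp
  show "x \<in> S j \<Longrightarrow> m < j \<Longrightarrow> E (Suc m) x \<in> H" by (drule d) simp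
  show "x \<in> S j \<Longrightarrow> m < j \<Longrightarrow> E (Suc m) x \<subseteq> S m \<union> S (Suc m)" by (drule d) simp
  show "x \<in> S j \<Longrightarrow> m < j \<Longrightarrow> card (E m x \<inter> E (Suc m) x) = 1" by (drule d) simp
  assume "x \<in> S j" "y \<in> S j" "m < j"
  from p[OF this]
  show "E m x \<inter> E (Suc m) y \<noteq> {} \<Longrightarrow> E m x = E m y"
    "E m x = E m y \<Longrightarrow> E (Suc m) x \<inter> E (Suc m) y \<noteq> {}"
    "E (Suc m) x = E (Suc m) y \<or> card (E (Suc m) x \<inter> E (Suc m) y) \<le> 1"
    by blast+
qed

lemma loose_tree_root: "v \<in> W \<Longrightarrow> loose_tree H W 0 (\<lambda>_. {v}) (\<lambda>_ _. {v})"
  by (auto simp: loose_tree_def)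

text \<open>The colours of level \<open>j\<close>: \<open>0\<close> for the vertices at which new edges are attached, \<open>1\<close> for the other
  vertices of the edges below, \<open>2\<close> for the other vertices of the new edges. Thus an old and a new
  edge can only share an attachment vertex.\<close>

lemma loose_tree_extend:
  fixes col :: "'a \<Rightarrow> nat"
  assumes tree: "loose_tree H W j S E"
    and G: "G \<subseteq> H" "\<And>e. e \<in> G \<Longrightarrow> e \<subseteq> W"
    and disj: "\<And>e m. e \<in> G \<Longrightarrow> m < j \<Longrightarrow> e \<inter> S m = {}"
    and \<alpha>: "\<And>e. e \<in> G \<Longrightarrow> \<alpha> e \<in> e \<inter> S j"
    and lin: "\<And>e e'. e \<in> G \<Longrightarrow> e' \<in> G \<Longrightarrow> e = e' \<or> card (e \<inter> e') \<le> 1"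
    and core: "\<And>e. e \<in> G \<Longrightarrow> col (\<alpha> e) = 0"
    and low: "\<And>e u. e \<in> G \<Longrightarrow> u \<in> E j (\<alpha> e) \<inter> S j \<Longrightarrow> u \<noteq> \<alpha> e \<Longrightarrow> col u = 1"
    and high: "\<And>e u. e \<in> G \<Longrightarrow> u \<in> e \<inter> S j \<Longrightarrow> u \<noteq> \<alpha> e \<Longrightarrow> col u = 2"
  shows "\<exists>E'. loose_tree H W (Suc j) (S(Suc j := \<Union>G - S j)) E'"
proof -
  define S' where "S' = S(Suc j := \<Union>G - S j)"
  \<comment> \<open>The branch of a new leaf \<open>b\<close> is the branch of the attachment vertex
    \<open>\<alpha> (\<epsilon> b)\<close> followed by one chosen new edge
    \<open>\<epsilon> b\<close> through \<open>b\<close>.\<close>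
  define \<epsilon> where "\<epsilon> b = (SOME e. e \<in> G \<and> b \<in> e)" for b
  define E' where "E' m b = (if m \<le> j then E m (\<alpha> (\<epsilon> b)) else \<epsilon> b)" for m b
  note t = loose_treeD[OF tree]
  have \<epsilon>: "\<epsilon> b \<in> G" "b \<in> \<epsilon> b" if "b \<in> S' (Suc j)" for b
  proof -
    have "\<exists>e. e \<in> G \<and> b \<in> e" using that by (auto simp: S'_def)
    from someI_ex[OF this] show "\<epsilon> b \<in> G" "b \<in> \<epsilon> b" by (auto simp: \<epsilon>_def)
  qed
  have a: "\<alpha> (\<epsilon> b) \<in> S j" "\<alpha> (\<epsilon> b) \<in> \<epsilon> b" if "b \<in> S' (Suc j)" for b
    using \<alpha>[OF \<epsilon>(1)[OF that]] by auto
  have Ej: "E j x \<inter> e \<subseteq> S j" if "x \<in> S j" "e \<in> G" for x e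
  proof (cases j)
    case 0
    then show ?thesis using t(5)[OF that(1)] by auto
  next
    case (Suc i)
    then have "E j x \<subseteq> S i \<union> S j" using t(7)[OF that(1), of i] by simp
    then show ?thesis using disj[OF that(2), of i] Suc by auto
  qed
  have cross: "E j (\<alpha> e) \<inter> e' \<subseteq> {\<alpha> e'} \<and> (E j (\<alpha> e) \<inter> e' \<noteq> {} \<longrightarrow> \<alpha> e = \<alpha> e')"
    if "e \<in> G" "e' \<in> G" for e e'
  proof -
    have "u = \<alpha> e \<and> u = \<alpha> e'" if u: "u \<in> E j (\<alpha> e) \<inter> e'" for u
    proof -
      have "u \<in> S j" using u Ej[of "\<alpha> e" e'] \<alpha> \<open>e \<in> G\<close> \<open>e' \<in> G\<close> by blast
      then show ?thesis
        using u low[OF \<open>e \<in> G\<close>, of u] high[OF \<open>e' \<in> G\<close>, of u] core[OF \<open>e \<in> G\<close>] core[OF \<open>e' \<in> G\<close>]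
        by (metis Int_iff One_nat_def n_not_Suc_n numeral_2_eq_2 old.nat.distinct(1))
    qed
    then show ?thesis by blast
  qed
  have S'j: "S' m = S m" if "m \<le> j" for m using that by (simp add: S'_def)
  have "loose_tree H W (Suc j) S' E'"
    unfolding loose_tree_def
  proof (intro conjI ballI allI impI)
    show "card (S' 0) = 1" using t(1) by (simp add: S'_def)
    show "S' m \<subseteq> W" if "m \<le> Suc j" for m
      using that t(2) G(2) by (auto simp: S'_def)
    show "S' m \<inter> S' m' = {}" if "m < m' \<and> m' \<le> Suc j" for m m'
    proof (cases "m' = Suc j")
      case True
      then have "m < j \<or> m = j" using that by auto
      then show ?thesis using True disj by (auto simp: S'_def)
    next
      case False
      then show ?thesis using t(3)[of m m'] that by (auto simp: S'_def)
    qed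
  next
    fix b assume b: "b \<in> S' (Suc j)"
    show "b \<in> E' (Suc j) b" using \<epsilon>[OF b] by (simp add: E'_def)
    show "E' 0 b = S' 0" using t(5)[OF a(1)[OF b]] by (simp add: E'_def S'_def)
    fix m assume m: "m < Suc j"
    show "E' (Suc m) b \<in> H"
      using m t(6)[OF a(1)[OF b], of m] \<epsilon>[OF b] G(1) by (auto simp: E'_def)
    show "E' (Suc m) b \<subseteq> S' m \<union> S' (Suc m)"
    proof (cases "m = j")
      case True
      then show ?thesis using \<epsilon>[OF b] by (auto simp: E'_def S'_def)
    next
      case False
      then show ?thesis using m t(7)[OF a(1)[OF b], of m] by (auto simp: E'_def S'_def)
    qed
    show "card (E' m b \<inter> E' (Suc m) b) = 1"
    proof (cases "m = j")
      case True
      have "E j (\<alpha> (\<epsilon> b)) \<inter> \<epsilon> b = {\<alpha> (\<epsilon> b)}"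
        using cross[OF \<epsilon>(1)[OF b] \<epsilon>(1)[OF b]] t(4)[OF a(1)[OF b]] a(2)[OF b] by auto
      then show ?thesis using True by (simp add: E'_def)
    next
      case False
      then show ?thesis using m t(8)[OF a(1)[OF b], of m] by (auto simp: E'_def)
    qed
  next
    fix b c m assume b: "b \<in> S' (Suc j)" and c: "c \<in> S' (Suc j)" and m: "m < Suc j"
    note ab = a(1)[OF b] and ac = a(1)[OF c]
    show "E' m b = E' m c" if "E' m b \<inter> E' (Suc m) c \<noteq> {}"
    proof (cases "m = j")
      case True
      then show ?thesis using that cross[OF \<epsilon>(1)[OF b] \<epsilon>(1)[OF c]] by (auto simp: E'_def)
    next
      case False
      then show ?thesis using that m t(9)[OF ab ac, of m] by (auto simp: E'_def)
    qed
    show "E' (Suc m) b \<inter> E' (Suc m) c \<noteq> {}" if "E' m b = E' m c"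
    proof (cases "m = j")
      case True
      then have "\<alpha> (\<epsilon> c) \<in> E j (\<alpha> (\<epsilon> b))" using that t(4)[OF ac] by (simp add: E'_def)
      then have "\<alpha> (\<epsilon> b) = \<alpha> (\<epsilon> c)"
        using cross[OF \<epsilon>(1)[OF b] \<epsilon>(1)[OF c]] a(2)[OF c] by blast
      then show ?thesis using True a(2)[OF b] a(2)[OF c] by (auto simp: E'_def)
    next
      case False
      then show ?thesis using that m t(10)[OF ab ac, of m] by (auto simp: E'_def)
    qed
    show "E' (Suc m) b = E' (Suc m) c \<or> card (E' (Suc m) b \<inter> E' (Suc m) c) \<le> 1"
    proof (cases "m = j")
      case True
      then show ?thesis using lin[OF \<epsilon>(1)[OF b] \<epsilon>(1)[OF c]] by (auto simp: E'_def)
    next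
      case False
      then show ?thesis using m t(11)[OF ab ac, of m] by (auto simp: E'_def)
    qed
  qed
  then show ?thesis unfolding S'_def by blast
qed

section \<open>Growing a loose tree by one level\<close>

context sparse_hypergraph
begin

text \<open>The losses in one growth step: a factor 2 for discarded vertices, the next factor for
  making the new edges pairwise meet in at most one vertex, and \<open>3 ^ (2 * r)\<close> for the
  three-colouring of level \<open>j\<close>.\<close>

definition growth_const :: nat where
  "growth_const = 2 * (2 * (r * r * D * r) + 1) * 3 ^ (2 * r)"

lemma loose_tree_edge_size:
  assumes "loose_tree H W j S E" "x \<in> S j" "m \<le> j" "r > 0"
  shows "finite (E m x) \<and> card (E m x) \<le> r"
proof (cases m)
  case 0
  then show ?thesis using loose_treeD(1,5)[OF assms(1)] assms by (simp add: card_ge_0_finite)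
next
  case (Suc i)
  then show ?thesis using loose_treeD(6)[OF assms(1,2), of i] assms(3) edge_finite edge_card_le by auto
qed

text \<open>Every neighbour \<open>x\<close> of level \<open>j\<close> outside \<open>Old\<close>
  and \<open>S j\<close> picks an edge \<open>G x\<close> back to level \<open>j\<close>. Such an
  edge misses all earlier levels, as otherwise \<open>x\<close> would lie in \<open>Old\<close>. The
  assumption \<open>big\<close> ensures that \<open>Old\<close>, \<open>S j\<close> and the vertices
  with badly overlapping edges make up at most half of the neighbourhood.\<close>

lemma loose_tree_grow:
  assumes tree: "loose_tree H W j S E" and "finite W" and r: "r > 0"
    and Old: "\<And>m. m < j \<Longrightarrow> nbhd H W (S m) \<subseteq> Old" "finite Old"
    and big: "card (nbhd H W (S j)) \<ge> 2 * (card Old + (1 + r * r * D * r) * card (S j))"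
  shows "\<exists>S' E'. loose_tree H W (Suc j) S' E' \<and> (\<forall>m\<le>j. S' m = S m) \<and>
    card (nbhd H W (S j)) \<le> growth_const * card (S' (Suc j))"
proof -
  note t = loose_treeD[OF tree]
  define \<kappa> where "\<kappa> = r * r * D * r"
  define N where "N = nbhd H W (S j)"
  have finS: "finite (S j)" using t(2)[of j] \<open>finite W\<close> finite_subset by blast
  have "N \<subseteq> W" using t(2)[of j] by (auto simp: N_def nbhd_def)
  then have finN: "finite N" using \<open>finite W\<close> finite_subset by blast
  define X where "X = N - (Old \<union> S j)"
  have finX: "finite X" using finN by (simp add: X_def)
  define G where "G x = (SOME e. e \<in> H \<and> e \<subseteq> W \<and> e \<inter> S j \<noteq> {} \<and> x \<in> e)" for x
  have G: "G x \<in> H" "G x \<subseteq> W" "G x \<inter> S j \<noteq> {}" "x \<in> G x" if "x \<in> X" for x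
  proof -
    have "\<exists>e. e \<in> H \<and> e \<subseteq> W \<and> e \<inter> S j \<noteq> {} \<and> x \<in> e"
      using that by (auto simp: X_def N_def nbhd_def)
    from someI_ex[OF this] show "G x \<in> H" "G x \<subseteq> W" "G x \<inter> S j \<noteq> {}" "x \<in> G x"
      by (auto simp: G_def)
  qed
  have Gdisj: "G x \<inter> S m = {}" if "x \<in> X" "m < j" for x m
  proof (rule ccontr)
    assume "G x \<inter> S m \<noteq> {}"
    then have "x \<in> nbhd H W (S m)" using G[OF that(1)] by (auto simp: nbhd_def)
    then show False using Old(1)[OF that(2)] that(1) by (auto simp: X_def)
  qed
  \<comment> \<open>The attachment vertex depends on the edge alone, so vertices that picked the
    same edge hang from the same place.\<close>
  define \<alpha> where "\<alpha> e = (SOME u. u \<in> e \<inter> S j)" for e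
  have \<alpha>: "\<alpha> (G x) \<in> G x \<inter> S j" if "x \<in> X" for x
    using G(3)[OF that] unfolding \<alpha>_def by (metis some_in_eq)
  define X1 where "X1 = {x\<in>X. card (G x \<inter> E j (\<alpha> (G x))) \<le> 1}"
  have size: "finite (E j a) \<and> card (E j a) \<le> r" if "a \<in> S j" for a
    using loose_tree_edge_size[OF tree that _ r] by simp
  have "X - X1 \<subseteq> (\<Union>a\<in>S j. \<Union>{e\<in>H. card (e \<inter> E j a) \<ge> 2})"
  proof
    fix x assume x: "x \<in> X - X1"
    then have "card (G x \<inter> E j (\<alpha> (G x))) \<ge> 2" by (auto simp: X1_def)
    then show "x \<in> (\<Union>a\<in>S j. \<Union>{e\<in>H. card (e \<inter> E j a) \<ge> 2})"
      using G[of x] \<alpha>[of x] x by blast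
  qed
  then have "card (X - X1) \<le> card (\<Union>a\<in>S j. \<Union>{e\<in>H. card (e \<inter> E j a) \<ge> 2})"
    using finS finite_edges edge_finite by (intro card_mono) auto
  also have "\<dots> \<le> (\<Sum>a\<in>S j. card (\<Union>{e\<in>H. card (e \<inter> E j a) \<ge> 2}))"
    using finS by (rule card_UN_le)
  also have "\<dots> \<le> (\<Sum>a\<in>S j. \<kappa>)"
    unfolding \<kappa>_def using size by (intro sum_mono card_Union_overlapping_le) auto
  finally have c1: "card (X - X1) \<le> card (S j) * \<kappa>" by simp
  have "N \<subseteq> Old \<union> S j \<union> (X - X1) \<union> X1" by (auto simp: X_def)
  then have "card N \<le> card (Old \<union> S j \<union> (X - X1) \<union> X1)"
    using finX finS Old(2) by (intro card_mono) (auto simp: X1_def)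
  also have "\<dots> \<le> card Old + card (S j) + card (X - X1) + card X1"
    by (meson add_mono card_Un_le order_refl order_trans)
  finally have cN: "card N \<le> 2 * card X1"
    using c1 big unfolding N_def[symmetric] \<kappa>_def[symmetric] by (simp add: algebra_simps)
  \<comment> \<open>Distinct vertices may keep a common edge; only different edges sharing two or
    more vertices conflict. Every \<open>y\<close> in conflict with \<open>x\<close> lies in one of
    the few edges that overlap \<open>G x\<close>, which bounds the outdegree by
    \<open>\<kappa>\<close>.\<close>
  have "\<exists>X2\<subseteq>X1. (\<forall>x\<in>X2. \<forall>y\<in>X2. x \<noteq> y \<longrightarrow> \<not> (G x \<noteq> G y \<and> card (G y \<inter> G x) \<ge> 2)) \<and>
      card X1 \<le> (2 * \<kappa> + 1) * card X2"
  proof (rule bounded_outdegree_independent)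
    show "finite X1" using finX by (simp add: X1_def)
    fix x assume "x \<in> X1"
    then have x: "x \<in> X" by (simp add: X1_def)
    have "card {y\<in>X1. G x \<noteq> G y \<and> 2 \<le> card (G y \<inter> G x)} \<le> card (\<Union>{e\<in>H. card (e \<inter> G x) \<ge> 2})"
    proof (rule card_mono)
      show "finite (\<Union>{e\<in>H. card (e \<inter> G x) \<ge> 2})" using finite_edges edge_finite by auto
      show "{y\<in>X1. G x \<noteq> G y \<and> 2 \<le> card (G y \<inter> G x)} \<subseteq> \<Union>{e\<in>H. card (e \<inter> G x) \<ge> 2}"
        using G by (fastforce simp: X1_def)
    qed
    also have "\<dots> \<le> \<kappa>" unfolding \<kappa>_def
      using G(1)[OF x] edge_finite edge_card_le by (intro card_Union_overlapping_le) auto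
    finally show "card {y\<in>X1. G x \<noteq> G y \<and> 2 \<le> card (G y \<inter> G x)} \<le> \<kappa>" .
  qed
  then obtain X2 where X2: "X2 \<subseteq> X1"
    "\<And>x y. x \<in> X2 \<Longrightarrow> y \<in> X2 \<Longrightarrow> x \<noteq> y \<Longrightarrow> \<not> (G x \<noteq> G y \<and> card (G y \<inter> G x) \<ge> 2)"
    "card X1 \<le> (2 * \<kappa> + 1) * card X2" by blast
  have X2X: "X2 \<subseteq> X" using X2(1) by (auto simp: X1_def)
  define Dm where "Dm x = (G x \<inter> S j) \<union> (E j (\<alpha> (G x)) \<inter> S j)" for x
  \<comment> \<open>These are the colours demanded by \<open>loose_tree_extend\<close>. The demands
    for 1 and 2 never clash on \<open>X1\<close>, where \<open>G x\<close> and the parent edge share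
    only \<open>\<alpha> (G x)\<close>.\<close>
  define \<sigma> where "\<sigma> x u = (if u = \<alpha> (G x) then 0 else if u \<in> G x then 2 else (1::nat))" for x u
  have "\<exists>g. card X2 \<le> 3 ^ (2 * r) * card {x\<in>X2. \<forall>u\<in>Dm x. g u = \<sigma> x u}"
  proof (rule exists_good_colouring[where K = "\<lambda>_. {0, 1, 2}"])
    show "finite X2" using X2X finX finite_subset by blast
    fix x assume "x \<in> X2"
    then have x: "x \<in> X" using X2X by blast
    have "\<alpha> (G x) \<in> S j" using \<alpha>[OF x] by blast
    then have "card (Dm x) \<le> card (G x \<inter> S j) + card (E j (\<alpha> (G x)) \<inter> S j)"
      unfolding Dm_def by (intro card_Un_le)
    also have "\<dots> \<le> card (G x) + card (E j (\<alpha> (G x)))"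
      using G(1)[OF x] edge_finite size[OF \<open>\<alpha> (G x) \<in> S j\<close>] by (intro add_mono card_mono) auto
    also have "\<dots> \<le> 2 * r"
      using G(1)[OF x] edge_card_le[of "G x"] size[OF \<open>\<alpha> (G x) \<in> S j\<close>] by simp
    finally show "finite (Dm x) \<and> card (Dm x) \<le> 2 * r" using finS by (simp add: Dm_def)
  qed (auto simp: \<sigma>_def)
  then obtain g where g: "card X2 \<le> 3 ^ (2 * r) * card {x\<in>X2. \<forall>u\<in>Dm x. g u = \<sigma> x u}" ..
  define X3 where "X3 = {x\<in>X2. \<forall>u\<in>Dm x. g u = \<sigma> x u}"
  have X3: "X3 \<subseteq> X" "X3 \<subseteq> X1" "X3 \<subseteq> X2" using X2X X2(1) by (auto simp: X3_def)
  have gD: "g u = \<sigma> x u" if "x \<in> X3" "u \<in> Dm x" for x u using that by (auto simp: X3_def)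
  have "\<exists>E'. loose_tree H W (Suc j) (S(Suc j := \<Union>(G ` X3) - S j)) E'"
  proof (rule loose_tree_extend[OF tree, where \<alpha> = \<alpha> and col = g])
    show "G ` X3 \<subseteq> H" "\<And>e. e \<in> G ` X3 \<Longrightarrow> e \<subseteq> W" using G(1,2) X3 by auto
    show "e \<inter> S m = {}" if "e \<in> G ` X3" "m < j" for e m using that Gdisj X3 by blast
    show "\<alpha> e \<in> e \<inter> S j" if "e \<in> G ` X3" for e using that \<alpha> X3 by blast
    show "e = e' \<or> card (e \<inter> e') \<le> 1" if ee: "e \<in> G ` X3" "e' \<in> G ` X3" for e e'
    proof -
      obtain x y where xy: "x \<in> X3" "e' = G x" "y \<in> X3" "e = G y" using ee by blast
      have "\<not> (G x \<noteq> G y \<and> card (G y \<inter> G x) \<ge> 2)"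
        using X2(2)[of x y] xy X3(3) by blast
      then show ?thesis using xy by auto
    qed
    fix e assume "e \<in> G ` X3"
    then obtain x where x: "x \<in> X3" "e = G x" by blast
    have ax: "\<alpha> (G x) \<in> G x \<inter> S j" using \<alpha> x X3 by blast
    show "g (\<alpha> e) = 0" using gD[OF x(1), of "\<alpha> e"] ax x(2) by (auto simp: Dm_def \<sigma>_def)
    fix u
    show "g u = 2" if "u \<in> e \<inter> S j" "u \<noteq> \<alpha> e"
      using gD[OF x(1), of u] that x(2) by (auto simp: Dm_def \<sigma>_def)
    show "g u = 1" if u: "u \<in> E j (\<alpha> e) \<inter> S j" "u \<noteq> \<alpha> e"
    proof -
      have "u \<notin> G x"
      proof
        assume "u \<in> G x"
        then have "{u, \<alpha> e} \<subseteq> G x \<inter> E j (\<alpha> (G x))" using u ax t(4)[of "\<alpha> e"] x(2) by auto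
        then have "card {u, \<alpha> e} \<le> card (G x \<inter> E j (\<alpha> (G x)))"
          using size[of "\<alpha> e"] ax x(2) by (intro card_mono) auto
        also have "\<dots> \<le> 1" using x(1) X3(2) by (auto simp: X1_def)
        finally show False using u(2) by simp
      qed
      then show ?thesis using gD[OF x(1), of u] u x(2) by (auto simp: Dm_def \<sigma>_def)
    qed
  qed
  then obtain E' where E': "loose_tree H W (Suc j) (S(Suc j := \<Union>(G ` X3) - S j)) E'" ..
  have "X3 \<subseteq> \<Union>(G ` X3) - S j" using G(4) X3(1) by (auto simp: X_def)
  moreover have "finite (\<Union>(G ` X3) - S j)"
    using G(1) X3(1) edge_finite finite_subset[OF X3(1) finX] by blast
  ultimately have "card X3 \<le> card (\<Union>(G ` X3) - S j)" by (rule card_mono[rotated])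
  have "card N \<le> 2 * ((2 * \<kappa> + 1) * card X2)" using cN X2(3) by linarith
  also have "\<dots> \<le> 2 * ((2 * \<kappa> + 1) * (3 ^ (2 * r) * card X3))"
    using g unfolding X3_def[symmetric] by (intro mult_le_mono2)
  also have "\<dots> = growth_const * card X3" by (simp add: growth_const_def \<kappa>_def algebra_simps)
  also have "\<dots> \<le> growth_const * card (\<Union>(G ` X3) - S j)"
    using \<open>card X3 \<le> _\<close> by (rule mult_le_mono2)
  finally have "card N \<le> growth_const * card (\<Union>(G ` X3) - S j)" .
  then show ?thesis using E' unfolding N_def
    by (intro exI[of _ "S(Suc j := \<Union>(G ` X3) - S j)"] exI[of _ E']) auto
qed

end

section \<open>Independent sets in the levels of a loose tree\<close>

definition cycle_free :: "nat \<Rightarrow> 'a set set \<Rightarrow> bool" where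
  "cycle_free l H \<longleftrightarrow> \<not> (\<exists>e. cyclic_edges l e \<and> (\<forall>a<l. e a \<in> H))"

lemma loose_tree_far_levels:
  assumes tree: "loose_tree H W i S E" and "x \<in> S i" "y \<in> S i" "0 < a" "Suc a < b" "b \<le> i"
  shows "E a x \<inter> E b y = {}"
proof -
  obtain a' b' where ab: "a = Suc a'" "b = Suc b'" using assms by (metis Suc_lessD gr0_conv_Suc less_trans)
  have "E a x \<subseteq> S a' \<union> S (Suc a')" "E b y \<subseteq> S b' \<union> S (Suc b')"
    using loose_treeD(7)[OF tree] assms ab by auto
  moreover have "S a' \<inter> S b' = {}" "S a' \<inter> S (Suc b') = {}" "S (Suc a') \<inter> S b' = {}"
    "S (Suc a') \<inter> S (Suc b') = {}"
    using assms ab by (auto intro!: loose_treeD(3)[OF tree])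
  ultimately show ?thesis by blast
qed

text \<open>If edges on consecutive levels of the two branches met, the branches would have the same
  edge on the lower of these levels and so would meet on the upper one, beyond
  \<open>m\<close>.\<close>

lemma loose_tree_branches_disjoint:
  assumes tree: "loose_tree H W i S E" and xy: "x \<in> S i" "y \<in> S i"
    and m: "0 < m" and dis: "\<And>a. m < a \<Longrightarrow> a \<le> i \<Longrightarrow> E a x \<inter> E a y = {}"
    and ab: "m \<le> a" "a \<le> i" "m \<le> b" "b \<le> i" "a \<noteq> m \<or> b \<noteq> m"
  shows "E a x \<inter> E b y = {}"
proof -
  have step: "E a z \<inter> E (Suc a) w = {}"
    if z: "z \<in> S i" "w \<in> S i" "\<And>a. m < a \<Longrightarrow> a \<le> i \<Longrightarrow> E a z \<inter> E a w = {}"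
      and a: "m \<le> a" "Suc a \<le> i" for z w a
  proof (rule ccontr)
    assume "E a z \<inter> E (Suc a) w \<noteq> {}"
    then have "E a z = E a w" using loose_treeD(9)[OF tree z(1,2)] a by simp
    then have "E (Suc a) z \<inter> E (Suc a) w \<noteq> {}" using loose_treeD(10)[OF tree z(1,2)] a by simp
    then show False using z(3)[of "Suc a"] a by auto
  qed
  consider "a = b" | "b = Suc a" | "a = Suc b" | "Suc a < b" | "Suc b < a" by linarith
  then show ?thesis
  proof cases
    case 1
    then show ?thesis using dis[of a] ab by auto
  next
    case 2
    then show ?thesis using step[of x y a] dis xy ab by auto
  next
    case 3
    then show ?thesis using step[of y x b] dis xy ab by (auto simp: Int_commute)
  next
    case 4
    then show ?thesis using loose_tree_far_levels[OF tree xy, of a b] m ab by simp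
  next
    case 5
    then show ?thesis using loose_tree_far_levels[OF tree xy(2,1), of b a] m ab
      by (simp add: Int_commute)
  qed
qed

context sparse_hypergraph
begin

text \<open>Each branch contributes its \<open>h = Suc (i - m)\<close> edges on levels
  \<open>m\<close> to \<open>i\<close>, and \<open>p\<close> is chosen so that
  \<open>2 * h + p = 2 * k + 1\<close>.\<close>

lemma close_cycle:
  assumes tree: "loose_tree H W i S E" and T: "T \<subseteq> S i"
    and sep: "\<And>u z. u \<in> T \<Longrightarrow> z \<in> T \<Longrightarrow> u \<in> E i z \<Longrightarrow> u = z"
    and m: "0 < m" "m \<le> i" "i \<le> k"
    and xy: "x \<in> T" "y \<in> T" "x \<noteq> y" "E m x \<inter> E m y \<noteq> {}"
    and dis: "\<And>a. m < a \<Longrightarrow> a \<le> i \<Longrightarrow> E a x \<inter> E a y = {}"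
    and p: "p = 2 * (k - Suc (i - m)) + 1"
    and e: "\<And>j. j < p \<Longrightarrow> e j \<in> H \<and> e j \<subseteq> T"
    and path: "\<And>j j'. j < j' \<Longrightarrow> j' < p \<Longrightarrow> card (e j \<inter> e j') = (if j' = Suc j then 1 else 0)"
    and ye: "\<And>j. j < p \<Longrightarrow> y \<in> e j \<longleftrightarrow> j = 0"
    and xe: "\<And>j. j < p \<Longrightarrow> x \<in> e j \<longleftrightarrow> Suc j = p"
  shows "\<exists>C. cyclic_edges (2 * k + 1) C \<and> (\<forall>a<2 * k + 1. C a \<in> H)"
proof -
  note t = loose_treeD[OF tree]
  have xS: "x \<in> S i" and yS: "y \<in> S i" using xy T by auto
  define h where "h = Suc (i - m)"
  have h: "0 < h" "h \<le> k" "2 * h + p = 2 * k + 1" using m p by (auto simp: h_def)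
  have own: "card (E b z \<inter> E a z) = (if a = Suc b then 1 else 0)"
    if "z \<in> S i" "0 < b" "b < a" "a \<le> i" for a b z
  proof (cases "a = Suc b")
    case True
    then show ?thesis using t(8)[OF that(1), of b] that by simp
  next
    case False
    then show ?thesis using loose_tree_far_levels[OF tree that(1,1), of b a] that by simp
  qed
  have meet: "card (E m x \<inter> E m y) = 1"
  proof -
    \<comment> \<open>Equality at \<open>m = i\<close> would put \<open>x\<close> into the last edge
      of \<open>y\<close>, against \<open>sep\<close>; equality at \<open>m < i\<close> would make
      the branches meet again at level \<open>m + 1\<close>.\<close>
    have ne: "E m x \<noteq> E m y"
    proof
      assume eq: "E m x = E m y"
      show False
      proof (cases "m = i")
        case True
        then show False using eq t(4)[OF xS] sep[OF xy(1,2)] xy(3) by auto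
      next
        case False
        then show False using t(10)[OF xS yS _ eq] dis[of "Suc m"] m by auto
      qed
    qed
    obtain m' where "m = Suc m'" using m by (cases m) auto
    then have "card (E m x \<inter> E m y) \<le> 1" using t(11)[OF xS yS, of m'] m ne by auto
    moreover have "finite (E m x)"
      using t(6)[OF xS, of m'] m \<open>m = Suc m'\<close> edge_finite by auto
    then have "card (E m x \<inter> E m y) \<noteq> 0" using xy(4) by auto
    ultimately show ?thesis by simp
  qed
  \<comment> \<open>Only the last edge of a branch reaches level \<open>i\<close>, and by
    \<open>sep\<close> it contains no vertex of \<open>T\<close> other than its own leaf.\<close>
  have top: "card (E a z \<inter> e j) = (if a = i \<and> z \<in> e j then 1 else 0)"
    if z: "z \<in> T" and a: "0 < a" "a \<le> i" and j: "j < p" for z a j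
  proof (cases "a = i")
    case True
    have "E i z \<inter> e j = (if z \<in> e j then {z} else {})"
      using sep[of _ z] e[OF j] t(4)[of z] z T by auto
    then show ?thesis using True by simp
  next
    case False
    then obtain a' where a': "a = Suc a'" "Suc a' < i" using a by (metis gr0_conv_Suc le_neq_implies_less)
    have "E a z \<subseteq> S a' \<union> S (Suc a')" using t(7)[of z a'] z T a' by auto
    moreover have "S a' \<inter> S i = {}" "S (Suc a') \<inter> S i = {}" using a' by (auto intro!: t(3))
    ultimately have "E a z \<inter> e j = {}" using e[OF j] T by blast
    then show ?thesis using False by simp
  qed
  \<comment> \<open>down to the meeting point along the branch of \<open>x\<close>, up along that of \<open>y\<close>, back along the path \<open>e\<close>\<close>
  define C where "C a = (if a < h then E (i - a) x else if a < 2 * h then E (m + (a - h)) y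
    else e (a - 2 * h))" for a
  have "cyclic_edges (2 * k + 1) C"
    unfolding cyclic_edges_def
  proof (intro allI impI)
    fix a b assume ab: "a < b \<and> b < 2 * k + 1"
    \<comment> \<open>The cases record in which of the three arcs \<open>a\<close> and
      \<open>b\<close> lie. The wrap-around pair \<open>0\<close>, \<open>2 * k\<close> occurs in
      the fourth, where the branch of \<open>x\<close> meets the last path edge.\<close>
    consider "b < h" | "a < h" "h \<le> b" "b < 2 * h" | "h \<le> a" "b < 2 * h" |
      "a < h" "2 * h \<le> b" | "h \<le> a" "a < 2 * h" "2 * h \<le> b" | "2 * h \<le> a" using ab by linarith
    then show "card (C a \<inter> C b) = (if b = Suc a \<or> a = 0 \<and> b = 2 * k + 1 - 1 then 1 else 0)"
    proof cases
      case 1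
      have "C a \<inter> C b = E (i - b) x \<inter> E (i - a) x" using 1 ab by (auto simp: C_def)
      moreover have "i - b < i - a" "0 < i - b" "i - a = Suc (i - b) \<longleftrightarrow> b = Suc a"
        using 1 ab m by (auto simp: h_def)
      ultimately show ?thesis using own[OF xS, of "i - b" "i - a"] 1 h by auto
    next
      case 2
      have C: "C a \<inter> C b = E (i - a) x \<inter> E (m + (b - h)) y" using 2 by (simp add: C_def)
      have r: "m \<le> i - a" "m + (b - h) \<le> i" using 2 m by (auto simp: h_def)
      show ?thesis
      proof (cases "b = Suc a")
        case True
        then have "i - a = m" "m + (b - h) = m" using 2 m by (auto simp: h_def)
        then show ?thesis using C meet True by simp
      next
        case False
        then have "i - a \<noteq> m \<or> m + (b - h) \<noteq> m" using 2 m by (auto simp: h_def)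
        then have "C a \<inter> C b = {}" unfolding C
          using loose_tree_branches_disjoint[OF tree xS yS m(1) dis] r by simp
        moreover have "b \<noteq> 2 * k" using 2 h by linarith
        ultimately show ?thesis using False by simp
      qed
    next
      case 3
      have "C a \<inter> C b = E (m + (a - h)) y \<inter> E (m + (b - h)) y" using 3 ab by (simp add: C_def)
      moreover have "m + (a - h) < m + (b - h)" "m + (b - h) \<le> i"
        "m + (b - h) = Suc (m + (a - h)) \<longleftrightarrow> b = Suc a"
        using 3 ab m by (auto simp: h_def)
      ultimately show ?thesis using own[OF yS, of "m + (a - h)" "m + (b - h)"] 3 h m by auto
    next
      case 4
      have "C a \<inter> C b = E (i - a) x \<inter> e (b - 2 * h)" using 4 by (simp add: C_def)
      moreover have "0 < i - a" "b - 2 * h < p" "i - a = i \<longleftrightarrow> a = 0"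
        "Suc (b - 2 * h) = p \<longleftrightarrow> b = 2 * k + 1 - 1"
        using 4 ab m h by (auto simp: h_def)
      ultimately show ?thesis using top[OF xy(1), of "i - a" "b - 2 * h"] xe[of "b - 2 * h"] 4 h
        by auto
    next
      case 5
      have "C a \<inter> C b = E (m + (a - h)) y \<inter> e (b - 2 * h)" using 5 by (simp add: C_def)
      moreover have "0 < m + (a - h)" "m + (a - h) \<le> i" "b - 2 * h < p"
        "m + (a - h) = i \<and> b - 2 * h = 0 \<longleftrightarrow> b = Suc a"
        using 5 ab m h by (auto simp: h_def)
      ultimately show ?thesis using top[OF xy(2), of "m + (a - h)" "b - 2 * h"] ye[of "b - 2 * h"] 5 h
        by auto
    next
      case 6
      have "C a \<inter> C b = e (a - 2 * h) \<inter> e (b - 2 * h)" using 6 ab by (simp add: C_def)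
      moreover have "a - 2 * h < b - 2 * h" "b - 2 * h < p" "b - 2 * h = Suc (a - 2 * h) \<longleftrightarrow> b = Suc a"
        using 6 ab h by auto
      ultimately show ?thesis using path[of "a - 2 * h" "b - 2 * h"] 6 h by auto
    qed
  qed
  moreover have "C a \<in> H" if "a < 2 * k + 1" for a
  proof -
    have EH: "E b z \<in> H" if "0 < b" "b \<le> i" "z \<in> S i" for b z
      using t(6)[OF that(3), of "b - 1"] that by simp
    consider "a < h" | "h \<le> a" "a < 2 * h" | "2 * h \<le> a" by linarith
    then show ?thesis
    proof cases
      case 1
      then show ?thesis using EH[of "i - a" x] xS m by (simp add: C_def h_def)
    next
      case 2
      then show ?thesis using EH[of "m + (a - h)" y] yS m by (simp add: C_def h_def)
    next
      case 3
      then show ?thesis using e[of "a - 2 * h"] that h by (simp add: C_def)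
    qed
  qed
  ultimately show ?thesis by blast
qed

end

text \<open>Level 1 always qualifies, since all branches leave from the common root;
  \<open>m\<close> is the last level where they meet.\<close>

lemma loose_tree_meet:
  assumes tree: "loose_tree H W i S E" and "x \<in> S i" "y \<in> S i" "0 < i"
  shows "\<exists>m. 0 < m \<and> m \<le> i \<and> E m x \<inter> E m y \<noteq> {} \<and> (\<forall>a. m < a \<and> a \<le> i \<longrightarrow> E a x \<inter> E a y = {})"
proof -
  define M where "M = {m. 0 < m \<and> m \<le> i \<and> E m x \<inter> E m y \<noteq> {}}"
  have "E 0 x = E 0 y" using loose_treeD(5)[OF tree] assms by simp
  then have "Suc 0 \<in> M"
    using loose_treeD(10)[OF tree assms(2,3), of 0] assms(4) by (auto simp: M_def)
  moreover have fin: "finite M" by (auto simp: M_def)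
  ultimately have "Max M \<in> M" by (intro Max_in) auto
  then have "0 < Max M" "Max M \<le> i" "E (Max M) x \<inter> E (Max M) y \<noteq> {}" by (auto simp: M_def)
  moreover have "E a x \<inter> E a y = {}" if "Max M < a" "a \<le> i" for a
  proof (rule ccontr)
    assume "E a x \<inter> E a y \<noteq> {}"
    then have "a \<in> M" using that by (auto simp: M_def)
    then show False using Max_ge[OF fin] that(1) by (meson leD)
  qed
  ultimately show ?thesis by (metis (no_types))
qed

section \<open>Sparsity inside a level\<close>

context sparse_hypergraph
begin

text \<open>The factors pay for fixing the meeting level, for a two-colouring of both branches
  beyond it, for prescribing the meeting vertex at two leaves, and for the degree needed to build a
  path of up to \<open>2 * k + 1\<close> edges.\<close>

definition edge_const :: "nat \<Rightarrow> nat" where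
  "edge_const k = k * (2 ^ (2 * (k * r + 1)) * (r ^ 2 * ((2 * k + 1) * r * D)))"

text \<open>Among the given edges one keeps those whose chosen pair \<open>s f\<close>, \<open>t f\<close> has branches meeting at a fixed
  level \<open>m\<close>, at a vertex prescribed by \<open>\<omega>\<close>, and whose branches beyond level \<open>m\<close> are monochromatic in opposite
  colours. These properties propagate along paths: the ends of any path of odd length again
  have branches meeting exactly at level \<open>m\<close>.\<close>

lemma few_edges_in_level:
  fixes s t :: "'a set \<Rightarrow> 'a"
  assumes tree: "loose_tree H W i S E" and "finite W" and T: "T \<subseteq> S i"
    and sep: "\<And>u z. u \<in> T \<Longrightarrow> z \<in> T \<Longrightarrow> u \<in> E i z \<Longrightarrow> u = z"
    and i: "0 < i" "i \<le> k" and free: "cycle_free (2 * k + 1) H" and Y: "Y \<subseteq> T"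
    and F: "F \<subseteq> H" "\<And>f. f \<in> F \<Longrightarrow> f \<subseteq> T"
    and st: "\<And>f. f \<in> F \<Longrightarrow> s f \<in> f \<inter> Y \<and> t f \<in> f \<inter> Y \<and> s f \<noteq> t f"
  shows "card F \<le> edge_const k * card Y"
proof (rule ccontr)
  assume "\<not> ?thesis"
  then have big: "card F > edge_const k * card Y" by simp
  have finF: "finite F" using F(1) finite_edges finite_subset by blast
  obtain f0 where "f0 \<in> F" using big by fastforce
  then have r: "r > 0" using edge_card_ge[of f0] edge_card_le[of f0] F(1) by fastforce
  have stS: "s f \<in> S i" "t f \<in> S i" "s f \<in> T" "t f \<in> T" if "f \<in> F" for f
    using st[OF that] Y T by auto
  have Esize: "finite (E m x)" "card (E m x) \<le> r" if "x \<in> S i" "m \<le> i" for m x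
    using loose_tree_edge_size[OF tree that r] by auto
  have "\<exists>\<mu>. \<forall>f\<in>F. 0 < \<mu> f \<and> \<mu> f \<le> i \<and> E (\<mu> f) (s f) \<inter> E (\<mu> f) (t f) \<noteq> {} \<and>
      (\<forall>a. \<mu> f < a \<and> a \<le> i \<longrightarrow> E a (s f) \<inter> E a (t f) = {})"
    by (rule bchoice) (auto intro!: loose_tree_meet[OF tree] simp: stS i)
  then obtain \<mu> where \<mu>: "\<And>f. f \<in> F \<Longrightarrow> 0 < \<mu> f \<and> \<mu> f \<le> i"
      "\<And>f. f \<in> F \<Longrightarrow> E (\<mu> f) (s f) \<inter> E (\<mu> f) (t f) \<noteq> {}"
      "\<And>f a. f \<in> F \<Longrightarrow> \<mu> f < a \<Longrightarrow> a \<le> i \<Longrightarrow> E a (s f) \<inter> E a (t f) = {}" by blast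
  \<comment> \<open>Pigeonhole over the meeting levels, expressed as a colouring of a single
    point.\<close>
  have "\<exists>g. card F \<le> k ^ 1 * card {f\<in>F. \<forall>u\<in>{()}. g u = \<mu> f}"
    by (rule exists_good_colouring[where K = "\<lambda>_. {1..i}"])
      (use finF i \<mu>(1) in \<open>auto simp: Suc_leI\<close>)
  then obtain m where m: "card F \<le> k * card {f\<in>F. m = \<mu> f}" by auto
  define F1 where "F1 = {f\<in>F. m = \<mu> f}"
  have F1: "finite F1" "F1 \<subseteq> F" using finF by (auto simp: F1_def)
  have "F1 \<noteq> {}" using m big unfolding F1_def[symmetric] by auto
  then have mi: "0 < m" "m \<le> i" using \<mu>(1) by (auto simp: F1_def)
  have dis: "E a (s f) \<inter> E a (t f) = {}" if "f \<in> F1" "m < a" "a \<le> i" for f a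
    using \<mu>(3)[of f a] that by (auto simp: F1_def)
  \<comment> \<open>The part of the branch beyond level \<open>m\<close>. The leaf is inserted
    explicitly because the union is empty when \<open>m = i\<close>.\<close>
  define P where "P x = insert x (\<Union>a\<in>{m<..i}. E a x)" for x
  have Pdisj: "P (s f) \<inter> P (t f) = {}" if f: "f \<in> F1" for f
  proof -
    have fF: "f \<in> F" using f F1 by blast
    note S = stS[OF fF]
    have *: "E a (s f) \<inter> E b (t f) = {}" if "m < a" "a \<le> i" "m < b" "b \<le> i" for a b
      using loose_tree_branches_disjoint[OF tree S(1,2) mi(1) dis[OF f]] that by simp
    have notin: "u \<notin> E a z" if "u \<in> T" "z \<in> T" "u \<noteq> z" "m < a" "a \<le> i" for u z a
    proof
      assume u: "u \<in> E a z"
      have uS: "u \<in> S i" "z \<in> S i" using that T by auto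
      show False
      proof (cases "a = i")
        case True
        then show False using sep[of u z] that u by auto
      next
        case False
        define a' where "a' = a - 1"
        have a': "a = Suc a'" "Suc a' < i" using that False by (auto simp: a'_def)
        have "E a z \<subseteq> S a' \<union> S (Suc a')" using loose_treeD(7)[OF tree uS(2), of a'] a' by auto
        moreover have "S a' \<inter> S i = {}" "S (Suc a') \<inter> S i = {}"
          using a' by (auto intro!: loose_treeD(3)[OF tree])
        ultimately show False using u uS by blast
      qed
    qed
    have "s f \<noteq> t f" using st[OF fF] by blast
    then have "s f \<notin> E a (t f)" "t f \<notin> E a (s f)" if "m < a" "a \<le> i" for a
      using notin[OF S(3,4)] notin[OF S(4,3)] that by auto
    then show ?thesis using * \<open>s f \<noteq> t f\<close> unfolding P_def by fastforce
  qed
  have Psize: "finite (P x)" "card (P x) \<le> k * r + 1" if "x \<in> S i" for x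
  proof -
    have "card (\<Union>a\<in>{m<..i}. E a x) \<le> (\<Sum>a\<in>{m<..i}. card (E a x))"
      by (rule card_UN_le) simp
    also have "\<dots> \<le> (\<Sum>a\<in>{m<..i}. r)" using Esize[OF that] by (intro sum_mono) auto
    also have "\<dots> = (i - m) * r" by simp
    also have "\<dots> \<le> k * r" using i by (intro mult_le_mono1) simp
    finally have "card (\<Union>a\<in>{m<..i}. E a x) \<le> k * r" .
    moreover show "finite (P x)" using Esize[OF that] by (auto simp: P_def)
    ultimately show "card (P x) \<le> k * r + 1"
      by (simp add: P_def card_insert_if)
  qed
  have "\<exists>c. card F1 \<le> 2 ^ (2 * (k * r + 1)) *
      card {f\<in>F1. \<forall>u\<in>P (s f) \<union> P (t f). c u = (u \<in> P (s f))}"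
  proof (rule exists_good_colouring[where K = "\<lambda>_. UNIV"])
    fix f assume "f \<in> F1"
    then have fF: "f \<in> F" using F1 by blast
    note S = stS[OF fF]
    have "card (P (s f) \<union> P (t f)) \<le> card (P (s f)) + card (P (t f))" by (rule card_Un_le)
    then show "finite (P (s f) \<union> P (t f)) \<and> card (P (s f) \<union> P (t f)) \<le> 2 * (k * r + 1)"
      using Psize[OF S(1)] Psize[OF S(2)] by auto
  qed (use F1 in auto)
  then obtain c where c: "card F1 \<le> 2 ^ (2 * (k * r + 1)) *
      card {f\<in>F1. \<forall>u\<in>P (s f) \<union> P (t f). c u = (u \<in> P (s f))}" ..
  define F2 where "F2 = {f\<in>F1. \<forall>u\<in>P (s f) \<union> P (t f). c u = (u \<in> P (s f))}"
  have F2: "finite F2" "F2 \<subseteq> F1" "F2 \<subseteq> F" using F1 by (auto simp: F2_def)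
  define \<nu> where "\<nu> f = (SOME w. w \<in> E m (s f) \<inter> E m (t f))" for f
  have \<nu>: "\<nu> f \<in> E m (s f) \<inter> E m (t f)" if "f \<in> F2" for f
  proof -
    have "E m (s f) \<inter> E m (t f) \<noteq> {}" using \<mu>(2)[of f] that F2 by (auto simp: F1_def)
    then show ?thesis unfolding \<nu>_def by (metis some_in_eq)
  qed
  \<comment> \<open>A leaf \<open>u\<close> is coloured by a vertex of \<open>E m u\<close>. Two
    leaves of equal colour then have edges at level \<open>m\<close> that share that vertex, even if
    the leaves are the ends of a long path.\<close>
  have "\<exists>\<omega>. card F2 \<le> r ^ 2 * card {f\<in>F2. \<forall>u\<in>{s f, t f}. \<omega> u = \<nu> f}"
  proof (rule exists_good_colouring[where K = "E m"])
    show "finite F2" "r > 0" by (fact F2 r)+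
    fix f assume f: "f \<in> F2"
    then have fF: "f \<in> F" using F2 by blast
    note S = stS[OF fF]
    show "finite {s f, t f} \<and> card {s f, t f} \<le> 2" by (simp add: card_insert_if)
    fix u assume "u \<in> {s f, t f}"
    then show "\<nu> f \<in> E m u" "finite (E m u) \<and> card (E m u) \<le> r"
      using \<nu>[OF f] Esize[OF S(1) mi(2)] Esize[OF S(2) mi(2)] by auto
  qed
  then obtain \<omega> where \<omega>: "card F2 \<le> r ^ 2 * card {f\<in>F2. \<forall>u\<in>{s f, t f}. \<omega> u = \<nu> f}" ..
  define F3 where "F3 = {f\<in>F2. \<forall>u\<in>{s f, t f}. \<omega> u = \<nu> f}"
  have F3: "finite F3" "F3 \<subseteq> F2" "F3 \<subseteq> F1" "F3 \<subseteq> F" using F2 by (auto simp: F3_def)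
  have "card F \<le> k * (2 ^ (2 * (k * r + 1)) * (r ^ 2 * card F3))"
  proof -
    have "card F \<le> k * card F1" using m by (simp add: F1_def)
    also have "\<dots> \<le> k * (2 ^ (2 * (k * r + 1)) * card F2)"
      using c by (intro mult_le_mono2) (simp add: F2_def)
    also have "\<dots> \<le> k * (2 ^ (2 * (k * r + 1)) * (r ^ 2 * card F3))"
      using \<omega> by (intro mult_le_mono2) (simp add: F3_def)
    finally show ?thesis .
  qed
  then have "edge_const k * card Y < k * (2 ^ (2 * (k * r + 1)) * (r ^ 2 * card F3))"
    using big by linarith
  then have "k * (2 ^ (2 * (k * r + 1)) * (r ^ 2 * ((2 * k + 1) * r * D * card Y)))
      < k * (2 ^ (2 * (k * r + 1)) * (r ^ 2 * card F3))"
    unfolding edge_const_def by (simp only: mult.assoc)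
  then have "card F3 > ((2 * k + 1) * r * D) * card Y" by simp
  moreover have "finite Y"
    using Y T loose_treeD(2)[OF tree, of i] \<open>finite W\<close> finite_subset by (metis order_refl)
  moreover have "s f \<in> Y \<and> t f \<in> Y" if "f \<in> F3" for f using st[of f] that F3 by blast
  ultimately obtain F4 where F4: "F4 \<subseteq> F3" "F4 \<noteq> {}"
    "\<And>f z. f \<in> F4 \<Longrightarrow> z \<in> {s f, t f} \<Longrightarrow> card {g\<in>F4. z = s g \<or> z = t g} > (2 * k + 1) * r * D"
    using min_degree_subfamily[of Y F3 s t "(2 * k + 1) * r * D"] F3(1) by blast
  have F4F: "F4 \<subseteq> F1" "F4 \<subseteq> F2" "F4 \<subseteq> F" "F4 \<subseteq> H" using F4(1) F3 F(1) by auto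
  have cs: "c (s f)" "\<not> c (t f)" "\<omega> (s f) = \<omega> (t f)"
    "\<forall>u\<in>P (s f). c u" "\<forall>u\<in>P (t f). \<not> c u" "\<omega> (s f) \<in> E m (s f)" "\<omega> (t f) \<in> E m (t f)"
    if "f \<in> F4" for f
  proof -
    have f: "f \<in> F1" "f \<in> F2" "f \<in> F3" using that F4(1) F4F by auto
    have cu: "\<And>u. u \<in> P (s f) \<union> P (t f) \<Longrightarrow> c u = (u \<in> P (s f))" using f(2) by (auto simp: F2_def)
    show P: "\<forall>u\<in>P (s f). c u" "\<forall>u\<in>P (t f). \<not> c u" using cu Pdisj[OF f(1)] by auto
    show "c (s f)" "\<not> c (t f)" using P by (auto simp: P_def)
    have "\<omega> (s f) = \<nu> f" "\<omega> (t f) = \<nu> f" using f(3) by (auto simp: F3_def)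
    then show "\<omega> (s f) = \<omega> (t f)" "\<omega> (s f) \<in> E m (s f)" "\<omega> (t f) \<in> E m (t f)"
      using \<nu>[OF f(2)] by auto
  qed
  define p where "p = 2 * (k - Suc (i - m)) + 1"
  have "p \<le> 2 * k + 1" by (simp add: p_def)
  have deg: "card {g\<in>F4. z = s g \<or> z = t g} > p * r * D" if "f \<in> F4" "z = s f \<or> z = t f" for f z
  proof -
    have "p * r * D \<le> (2 * k + 1) * r * D" using \<open>p \<le> 2 * k + 1\<close> by (intro mult_le_mono1)
    also have "\<dots> < card {g\<in>F4. z = s g \<or> z = t g}" using that by (intro F4(3)[of f]) auto
    finally show ?thesis .
  qed
  have F4st: "s f \<in> f \<and> t f \<in> f \<and> c (s f) \<and> \<not> c (t f) \<and> \<omega> (s f) = \<omega> (t f)" if "f \<in> F4" for f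
    using st[of f] cs[OF that] that F4F by blast
  have "\<exists>e v. (\<forall>j<p. e j \<in> F4 \<and> v j \<in> e j \<and> v (Suc j) \<in> e j \<and> v j \<noteq> v (Suc j)) \<and>
    (\<forall>j j'. j < j' \<and> j' < p \<longrightarrow> e j \<inter> e j' = (if j' = Suc j then {v j'} else {})) \<and>
    (\<forall>j. Suc j < p \<longrightarrow> v p \<notin> e j) \<and>
    (\<exists>f\<in>F4. v 0 = s f \<or> v 0 = t f) \<and> (\<exists>f\<in>F4. v p = s f \<or> v p = t f) \<and>
    \<omega> (v p) = \<omega> (v 0) \<and> (c (v p) = c (v 0) \<longleftrightarrow> even p)"
    by (rule exists_loose_path[OF F4F(4) F4(2)]) (fact F4st deg)+
  then obtain e v where ev: "\<forall>j<p. e j \<in> F4 \<and> v j \<in> e j \<and> v (Suc j) \<in> e j \<and> v j \<noteq> v (Suc j)"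
    "\<forall>j j'. j < j' \<and> j' < p \<longrightarrow> e j \<inter> e j' = (if j' = Suc j then {v j'} else {})"
    "\<forall>j. Suc j < p \<longrightarrow> v p \<notin> e j"
    "\<exists>f\<in>F4. v 0 = s f \<or> v 0 = t f" "\<exists>f\<in>F4. v p = s f \<or> v p = t f"
    "\<omega> (v p) = \<omega> (v 0)" "c (v p) = c (v 0) \<longleftrightarrow> even p" by blast
  have ends: "z \<in> T \<and> (\<forall>u\<in>P z. c u = c z) \<and> \<omega> z \<in> E m z"
    if z: "\<exists>f\<in>F4. z = s f \<or> z = t f" for z
  proof -
    obtain f where f: "f \<in> F4" "z = s f \<or> z = t f" using z by blast
    then have "f \<in> F" using F4F by blast
    then show ?thesis using f cs[OF f(1)] stS[of f] by auto
  qed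
  define x y where "x = v p" and "y = v 0"
  have x: "x \<in> T" "\<forall>u\<in>P x. c u = c x" "\<omega> x \<in> E m x" using ends[OF ev(5)] by (auto simp: x_def)
  have y: "y \<in> T" "\<forall>u\<in>P y. c u = c y" "\<omega> y \<in> E m y" using ends[OF ev(4)] by (auto simp: y_def)
  \<comment> \<open>The length \<open>p\<close> is odd, so the alternating colour differs at the two
    ends.\<close>
  have cxy: "c x \<noteq> c y" using ev(7) by (auto simp: x_def y_def p_def)
  have "\<exists>C. cyclic_edges (2 * k + 1) C \<and> (\<forall>a<2 * k + 1. C a \<in> H)"
  proof (rule close_cycle[OF tree T sep mi i(2) x(1) y(1) _ _ _ p_def])
    show "x \<noteq> y" using cxy by blast
    have "\<omega> x = \<omega> y" using ev(6) by (simp add: x_def y_def)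
    then show "E m x \<inter> E m y \<noteq> {}" using x(3) y(3) by auto
    \<comment> \<open>Beyond \<open>m\<close> the two branches are monochromatic in opposite
      colours, hence disjoint.\<close>
    show "E a x \<inter> E a y = {}" if "m < a" "a \<le> i" for a
    proof -
      have "E a x \<subseteq> P x" "E a y \<subseteq> P y" using that by (auto simp: P_def)
      then show ?thesis using x(2) y(2) cxy by blast
    qed
    show "e j \<in> H \<and> e j \<subseteq> T" if "j < p" for j using ev(1) that F4F F(2) by blast
    show "card (e j \<inter> e j') = (if j' = Suc j then 1 else 0)" if "j < j'" "j' < p" for j j'
      using ev(2) that by auto
    show "x \<in> e j \<longleftrightarrow> Suc j = p" if "j < p" for j
      using ev(1,3) that by (metis Suc_lessI x_def)
    show "y \<in> e j \<longleftrightarrow> j = 0" if "j < p" for j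
    proof (cases "j = 0")
      case True
      then show ?thesis using ev(1) that by (auto simp: y_def)
    next
      case False
      then have "e 0 \<inter> e j \<subseteq> {v 1}" using ev(2) that by auto
      moreover have "y \<in> e 0" "y \<noteq> v 1" using ev(1) that by (auto simp: y_def)
      ultimately show ?thesis using False by auto
    qed
  qed auto
  then show False using free by (simp add: cycle_free_def)
qed

text \<open>The first factor pays for a subset \<open>T\<close> in which no leaf lies in the last
  edge of another, the second for greedy selection inside \<open>T\<close>.\<close>

definition level_const :: "nat \<Rightarrow> nat" where
  "level_const k = (2 * r + 1) * (2 * edge_const k + 1)"

text \<open>One pair of vertices represents each edge. By \<open>few_edges_in_level\<close> every
  subset \<open>Y\<close> of \<open>T\<close> spans only linearly many such pairs, so greedy
  selection finds a large set without a pair, and such a set contains no edge.\<close>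

lemma level_independent:
  assumes tree: "loose_tree H W i S E" and "finite W" and r: "r > 0"
    and i: "i \<le> k" and free: "cycle_free (2 * k + 1) H"
  shows "\<exists>I\<subseteq>S i. independent H I \<and> card (S i) \<le> level_const k * card I"
proof (cases "i = 0")
  case True
  have "card (S 0) = 1" using loose_treeD(1)[OF tree] .
  have "independent H (S 0)"
    unfolding independent_def
  proof (intro ballI notI)
    fix e assume e: "e \<in> H" "e \<subseteq> S 0"
    then have "card e \<le> card (S 0)"
      using \<open>card (S 0) = 1\<close> by (intro card_mono) (auto intro: card_ge_0_finite)
    then show False using edge_card_ge[OF e(1)] \<open>card (S 0) = 1\<close> by simp
  qed
  then show ?thesis using True by (intro exI[of _ "S 0"]) (simp add: level_const_def)
next
  case False
  have finS: "finite (S i)" using loose_treeD(2)[OF tree, of i] \<open>finite W\<close> finite_subset by blast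
  have "\<exists>T\<subseteq>S i. (\<forall>z\<in>T. \<forall>u\<in>T. z \<noteq> u \<longrightarrow> \<not> u \<in> E i z) \<and> card (S i) \<le> (2 * r + 1) * card T"
  proof (rule bounded_outdegree_independent[OF finS])
    fix z assume z: "z \<in> S i"
    have "card {u\<in>S i. u \<in> E i z} \<le> card (E i z)"
      using loose_tree_edge_size[OF tree z _ r] by (intro card_mono) auto
    also have "\<dots> \<le> r" using loose_tree_edge_size[OF tree z _ r] by simp
    finally show "card {u\<in>S i. u \<in> E i z} \<le> r" .
  qed
  then obtain T where T0: "T \<subseteq> S i" "\<forall>z\<in>T. \<forall>u\<in>T. z \<noteq> u \<longrightarrow> \<not> u \<in> E i z"
    "card (S i) \<le> (2 * r + 1) * card T" by (elim exE conjE)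
  have T: "T \<subseteq> S i" "\<And>u z. u \<in> T \<Longrightarrow> z \<in> T \<Longrightarrow> u \<in> E i z \<Longrightarrow> u = z"
    "card (S i) \<le> (2 * r + 1) * card T" using T0 by auto
  have finT: "finite T" using T(1) finS finite_subset by blast
  have "\<exists>st. \<forall>f\<in>H. fst (st f) \<in> f \<and> snd (st f) \<in> f \<and> fst (st f) \<noteq> snd (st f)"
  proof (rule bchoice, rule ballI)
    fix f assume "f \<in> H"
    then obtain p where "p \<subseteq> f" "card p = 2"
      using obtain_subset_with_card_n[OF edge_card_ge] by metis
    then obtain a b where "a \<in> f" "b \<in> f" "a \<noteq> b" by (auto simp: card_2_iff)
    then show "\<exists>y. fst y \<in> f \<and> snd y \<in> f \<and> fst y \<noteq> snd y" by (intro exI[of _ "(a, b)"]) simp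
  qed
  then obtain st where st: "\<And>f. f \<in> H \<Longrightarrow> fst (st f) \<in> f \<and> snd (st f) \<in> f \<and> fst (st f) \<noteq> snd (st f)"
    by blast
  define s t where "s f = fst (st f)" and "t f = snd (st f)" for f
  have sH: "s f \<in> f" and tH: "t f \<in> f" and stH: "s f \<noteq> t f" if "f \<in> H" for f
    using st[OF that] by (auto simp: s_def t_def)
  define R where "R x y \<longleftrightarrow> (\<exists>f\<in>H. f \<subseteq> T \<and> s f = x \<and> t f = y)" for x y
  define d where "d = edge_const k"
  have "\<exists>I\<subseteq>T. (\<forall>x\<in>I. \<forall>y\<in>I. x \<noteq> y \<longrightarrow> \<not> R x y) \<and> card T \<le> (2 * d + 1) * card I"
  proof (rule greedy_independent[OF finT])
    fix Y assume Y: "Y \<subseteq> T" "Y \<noteq> {}"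
    have finY: "finite Y" using Y finT finite_subset by blast
    define F where "F = {f\<in>H. f \<subseteq> T \<and> s f \<in> Y \<and> t f \<in> Y}"
    have finF: "finite F" using finite_edges by (simp add: F_def)
    have "card F \<le> d * card Y"
      unfolding d_def
      by (rule few_edges_in_level[OF tree \<open>finite W\<close> T(1,2) _ i free Y(1), where s = s and t = t])
        (use False in \<open>auto simp: F_def sH tH stH\<close>)
    \<comment> \<open>Each neighbour of \<open>y\<close> comes from an edge of \<open>F\<close>
      having \<open>y\<close> as one of its two chosen vertices, so the degrees in \<open>Y\<close>
      add up to at most \<open>2 * card F\<close>.\<close>
    have nb: "card {z\<in>Y. z \<noteq> y \<and> (R y z \<or> R z y)} \<le> card {f\<in>F. y = s f \<or> y = t f}"
      if "y \<in> Y" for y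
    proof (rule surj_card_le)
      show "finite {f\<in>F. y = s f \<or> y = t f}" using finF by simp
      show "{z\<in>Y. z \<noteq> y \<and> (R y z \<or> R z y)} \<subseteq>
          (\<lambda>f. if s f = y then t f else s f) ` {f\<in>F. y = s f \<or> y = t f}"
        using that by (auto simp: R_def F_def image_iff)
    qed
    have "(\<Sum>y\<in>Y. card {z\<in>Y. z \<noteq> y \<and> (R y z \<or> R z y)}) \<le> (\<Sum>y\<in>Y. card {f\<in>F. y = s f \<or> y = t f})"
      using nb by (rule sum_mono)
    also have "\<dots> = (\<Sum>f\<in>F. card {y\<in>Y. y = s f \<or> y = t f})" by (rule sum_card_swap[OF finY finF])
    also have "\<dots> \<le> (\<Sum>f\<in>F. 2)"
    proof (rule sum_mono)
      fix f
      have "card {y\<in>Y. y = s f \<or> y = t f} \<le> card {s f, t f}" by (rule card_mono) auto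
      also have "\<dots> \<le> 2" by (simp add: card_insert_if)
      finally show "card {y\<in>Y. y = s f \<or> y = t f} \<le> 2" .
    qed
    also have "\<dots> \<le> (2 * d) * card Y" using \<open>card F \<le> d * card Y\<close> by simp
    finally show "\<exists>y\<in>Y. card {z\<in>Y. z \<noteq> y \<and> (R y z \<or> R z y)} \<le> 2 * d"
      by (rule exists_le_average[OF finY Y(2)])
  qed
  then obtain I where I: "I \<subseteq> T" "\<And>x y. x \<in> I \<Longrightarrow> y \<in> I \<Longrightarrow> x \<noteq> y \<Longrightarrow> \<not> R x y"
    "card T \<le> (2 * d + 1) * card I" by blast
  have "independent H I"
    unfolding independent_def
  proof (intro ballI notI)
    fix f assume f: "f \<in> H" "f \<subseteq> I"
    then have "R (s f) (t f)" using I(1) by (auto simp: R_def)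
    then show False using I(2)[of "s f" "t f"] sH[OF f(1)] tH[OF f(1)] stH[OF f(1)] f(2) by blast
  qed
  moreover have "card (S i) \<le> level_const k * card I"
  proof -
    have "card (S i) \<le> (2 * r + 1) * card T" by (rule T(3))
    also have "\<dots> \<le> (2 * r + 1) * ((2 * d + 1) * card I)" using I(3) by (rule mult_le_mono2)
    finally show ?thesis by (simp only: level_const_def d_def mult.assoc)
  qed
  ultimately show ?thesis using I(1) T(1) by blast
qed

section \<open>Expansion of levels and iteration\<close>

definition stage_const :: nat where
  "stage_const = 2 * (2 * growth_const + 1 + r * r * D * r)"

lemma growth_const_pos: "growth_const > 0"
  by (simp add: growth_const_def)

text \<open>The tree is grown as long as levels expand by more than \<open>q\<close>. A level that
  does not yields the first alternative; otherwise \<open>k\<close> expansions make level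
  \<open>k\<close> large, and its independent set yields the second.\<close>

lemma stage:
  assumes "finite W" "W \<noteq> {}" and r: "r > 0" and free: "cycle_free (2 * k + 1) H"
    and q: "q \<ge> stage_const"
  shows "(\<exists>S\<subseteq>W. \<exists>I\<subseteq>S. S \<noteq> {} \<and> independent H I \<and> card S \<le> level_const k * card I \<and>
      card (nbhd H W S) \<le> q * card S) \<or>
    (\<exists>I\<subseteq>W. independent H I \<and> q ^ k \<le> growth_const ^ k * (level_const k * card I))"
proof (rule ccontr)
  assume no: "\<not> ?thesis"
  obtain v where v: "v \<in> W" using \<open>W \<noteq> {}\<close> by blast
  have "\<exists>S E. loose_tree H W j S E \<and> S j \<noteq> {} \<and>
      card (\<Union>m<j. nbhd H W (S m)) \<le> 2 * growth_const * card (S j) \<and>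
      q ^ j \<le> growth_const ^ j * card (S j)" if "j \<le> k" for j
    using that
  proof (induction j)
    case 0
    show ?case
      by (intro exI[of _ "\<lambda>_. {v}"] exI[of _ "\<lambda>_ _. {v}"]) (use loose_tree_root[OF v] in simp)
  next
    case (Suc j)
    then obtain S E where SE: "loose_tree H W j S E" "S j \<noteq> {}"
      "card (\<Union>m<j. nbhd H W (S m)) \<le> 2 * growth_const * card (S j)"
      "q ^ j \<le> growth_const ^ j * card (S j)" by auto
    have nW: "nbhd H W (S m) \<subseteq> W" if "m \<le> j" for m
      using loose_treeD(2)[OF SE(1) that] by (auto simp: nbhd_def)
    then have finn: "finite (nbhd H W (S m))" if "m \<le> j" for m
      using that \<open>finite W\<close> finite_subset by blast
    obtain I where I: "I \<subseteq> S j" "independent H I" "card (S j) \<le> level_const k * card I"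
      using level_independent[OF SE(1) \<open>finite W\<close> r _ free] Suc.prems by auto
    have "S j \<subseteq> W" using loose_treeD(2)[OF SE(1), of j] by simp
    then have large: "card (nbhd H W (S j)) > q * card (S j)"
      using no I SE(2) by (meson not_le)
    define Old where "Old = (\<Union>m<j. nbhd H W (S m))"
    have finOld: "finite Old" using finn by (auto simp: Old_def)
    \<comment> \<open>The constant \<open>stage_const\<close> is chosen for this inequality:
      expansion by \<open>q\<close> must outweigh what \<open>loose_tree_grow\<close> may discard,
      given that \<open>Old\<close> is at most \<open>2 * growth_const\<close> times the
      level.\<close>
    have "2 * (card Old + (1 + r * r * D * r) * card (S j)) \<le> stage_const * card (S j)"
      using SE(3) unfolding Old_def[symmetric] stage_const_def by (simp add: algebra_simps)
    also have "\<dots> \<le> q * card (S j)" using q by (rule mult_le_mono1)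
    finally have "2 * (card Old + (1 + r * r * D * r) * card (S j)) \<le> card (nbhd H W (S j))"
      using large by linarith
    then obtain S' E' where S': "loose_tree H W (Suc j) S' E'" "\<And>m. m \<le> j \<Longrightarrow> S' m = S m"
      "card (nbhd H W (S j)) \<le> growth_const * card (S' (Suc j))"
      using loose_tree_grow[OF SE(1) \<open>finite W\<close> r _ finOld] by (force simp: Old_def)
    have "(\<Union>m<Suc j. nbhd H W (S' m)) = Old \<union> nbhd H W (S j)"
      using S'(2) by (auto simp: Old_def less_Suc_eq)
    then have "card (\<Union>m<Suc j. nbhd H W (S' m)) \<le> card Old + card (nbhd H W (S j))"
      by (simp add: card_Un_le)
    \<comment> \<open>The old neighbourhoods amount to at most half of the newest one, so the bound
      on their union carries over to the next level with the same constant.\<close>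
    also have "\<dots> \<le> 2 * card (nbhd H W (S j))"
      using \<open>2 * (card Old + _) \<le> card (nbhd H W (S j))\<close> by simp
    also have "\<dots> \<le> 2 * growth_const * card (S' (Suc j))" using S'(3) by simp
    finally have c: "card (\<Union>m<Suc j. nbhd H W (S' m)) \<le> 2 * growth_const * card (S' (Suc j))" .
    have "q ^ Suc j \<le> growth_const ^ j * (q * card (S j))"
      using mult_le_mono2[OF SE(4), of q] by (simp add: mult_ac)
    also have "\<dots> \<le> growth_const ^ j * card (nbhd H W (S j))"
      using large by (intro mult_le_mono2) simp
    also have "\<dots> \<le> growth_const ^ j * (growth_const * card (S' (Suc j)))"
      using S'(3) by (rule mult_le_mono2)
    finally have p: "q ^ Suc j \<le> growth_const ^ Suc j * card (S' (Suc j))" by (simp add: mult_ac)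
    have "card (S' (Suc j)) > 0" using S'(3) large by (cases "card (S' (Suc j)) = 0") auto
    then have "S' (Suc j) \<noteq> {}" by auto
    with S'(1) c p show ?case by blast
  qed
  then obtain S E where SE: "loose_tree H W k S E" "q ^ k \<le> growth_const ^ k * card (S k)" by blast
  obtain I where I: "I \<subseteq> S k" "independent H I" "card (S k) \<le> level_const k * card I"
    using level_independent[OF SE(1) \<open>finite W\<close> r _ free] by auto
  have "I \<subseteq> W" using I(1) loose_treeD(2)[OF SE(1), of k] by auto
  moreover have "q ^ k \<le> growth_const ^ k * (level_const k * card I)"
    using SE(2) mult_le_mono2[OF I(3)] order_trans by blast
  ultimately show False using no I(2) by blast
qed

text \<open>Independent sets from successive stages can be united: an edge inside \<open>W\<close>
  that meets \<open>S\<close> lies in the deleted neighbourhood, so it cannot reach into the later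
  part. Each stage deletes at most \<open>q * card S\<close>, hence at most
  \<open>level_const k * q\<close> vertices per vertex gained.\<close>

lemma large_independent_set:
  assumes "finite W" and r: "r > 0" and free: "cycle_free (2 * k + 1) H"
    and q: "q \<ge> stage_const" "growth_const ^ k * (level_const k * n) \<le> q ^ k" "q > 0"
  shows "\<exists>I\<subseteq>W. independent H I \<and> (n \<le> card I \<or> card W \<le> level_const k * q * card I)"
  using \<open>finite W\<close>
proof (induction "card W" arbitrary: W rule: less_induct)
  case less
  have lc: "growth_const ^ k * level_const k > 0"
    using growth_const_pos by (simp add: level_const_def)
  show ?case
  proof (cases "W = {}")
    case True
    have "independent H {}" using edge_card_ge[of "{}"] by (auto simp: independent_def)
    then show ?thesis using True by auto
  next
    case False
    from stage[OF less.prems False r free q(1)] show ?thesis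
    proof
      assume "\<exists>I\<subseteq>W. independent H I \<and> q ^ k \<le> growth_const ^ k * (level_const k * card I)"
      then obtain I where I: "I \<subseteq> W" "independent H I"
        "q ^ k \<le> growth_const ^ k * (level_const k * card I)" by blast
      have "growth_const ^ k * level_const k * n \<le> growth_const ^ k * level_const k * card I"
        using order_trans[OF q(2) I(3)] by (simp only: mult.assoc)
      then have "n \<le> card I" using lc by (metis nat_mult_le_cancel1)
      with I show ?thesis by blast
    next
      assume "\<exists>S\<subseteq>W. \<exists>I\<subseteq>S. S \<noteq> {} \<and> independent H I \<and> card S \<le> level_const k * card I \<and>
        card (nbhd H W S) \<le> q * card S"
      then obtain S I where S: "S \<subseteq> W" "I \<subseteq> S" "S \<noteq> {}" "independent H I"
        "card S \<le> level_const k * card I" "card (nbhd H W S) \<le> q * card S" by blast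
      define W' where "W' = W - nbhd H W S"
      have SN: "S \<subseteq> nbhd H W S" by (simp add: nbhd_def)
      have "card W' < card W" using S(1,3) SN less.prems
        by (intro psubset_card_mono) (auto simp: W'_def)
      moreover have "finite W'" using less.prems by (simp add: W'_def)
      ultimately obtain I' where I': "I' \<subseteq> W'" "independent H I'"
        "n \<le> card I' \<or> card W' \<le> level_const k * q * card I'"
        using less.hyps by blast
      show ?thesis
      proof (cases "n \<le> card I'")
        case True
        then show ?thesis using I' by (auto simp: W'_def)
      next
        case False
        have ind: "independent H (I \<union> I')"
          unfolding independent_def
        proof (intro ballI notI)
          fix e assume e: "e \<in> H" "e \<subseteq> I \<union> I'"
          then have eW: "e \<subseteq> W" using S I' by (auto simp: W'_def)
          show False
          proof (cases "e \<inter> S = {}")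
            case True
            then have "e \<subseteq> I'" using e(2) S(2) by blast
            then show False using I'(2) e(1) by (auto simp: independent_def)
          next
            case False
            then have "e \<subseteq> nbhd H W S" using e(1) eW by (auto simp: nbhd_def)
            then have "e \<subseteq> I" using e(2) I'(1) by (auto simp: W'_def)
            then show False using S(4) e(1) by (auto simp: independent_def)
          qed
        qed
        have "I \<inter> I' = {}" using S(2) SN I'(1) by (auto simp: W'_def)
        moreover have "finite I" "finite I'"
          using S(1,2) I'(1) less.prems \<open>finite W'\<close> finite_subset by (metis order_trans)+
        ultimately have cU: "card (I \<union> I') = card I + card I'" by (simp add: card_Un_disjoint)
        have "W \<subseteq> nbhd H W S \<union> W'" by (auto simp: W'_def)
        then have "card W \<le> card (nbhd H W S \<union> W')"
          using less.prems finite_subset[of "nbhd H W S" W] S(1)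
          by (intro card_mono) (auto simp: W'_def nbhd_def)
        also have "\<dots> \<le> card (nbhd H W S) + card W'" by (rule card_Un_le)
        also have "\<dots> \<le> q * (level_const k * card I) + level_const k * q * card I'"
          using S(6) mult_le_mono2[OF S(5), of q] I'(3) False by linarith
        also have "\<dots> = level_const k * q * card (I \<union> I')" unfolding cU by (simp add: algebra_simps)
        finally have "card W \<le> level_const k * q * card (I \<union> I')" .
        moreover have "I \<union> I' \<subseteq> W" using S(1,2) I'(1) by (auto simp: W'_def)
        ultimately show ?thesis using ind by blast
      qed
    qed
  qed
qed

end

section \<open>Reduction to sparse hypergraphs\<close>

text \<open>An Erdos-Rado type bound: the summand 1 allows for the set \<open>A\<close> itself,
  \<open>M * Suc d\<close> bounds the vertices outside \<open>A\<close> of fewer than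
  \<open>M\<close> petals, and each of these vertices lies in at most
  \<open>sunflower_bound M d\<close> sets.\<close>

fun sunflower_bound :: "nat \<Rightarrow> nat \<Rightarrow> nat" where
  "sunflower_bound M 0 = 1"
| "sunflower_bound M (Suc d) = 1 + M * Suc d * sunflower_bound M d"

text \<open>Erdos-Rado argument relative to a common part \<open>A\<close>. If a largest family of
  petals over \<open>A\<close> has fewer than \<open>M\<close> members, the vertices it covers
  outside \<open>A\<close> meet every set other than \<open>A\<close>; a popular one is added to
  \<open>A\<close>, which lowers \<open>d\<close>.\<close>

lemma sunflower_above:
  fixes C :: "'a set set"
  assumes "finite C" "finite A" "\<And>e. e \<in> C \<Longrightarrow> finite e \<and> A \<subseteq> e \<and> card e \<le> card A + d"
    and "card C > sunflower_bound M d"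
  shows "\<exists>A' Q. A \<subseteq> A' \<and> finite A' \<and> Q \<subseteq> C \<and> card Q = M \<and> (\<forall>e\<in>Q. A' \<subset> e) \<and>
    (\<forall>e\<in>Q. \<forall>e'\<in>Q. e \<noteq> e' \<longrightarrow> e \<inter> e' = A')"
  using assms
proof (induction d arbitrary: A C)
  case 0
  have "C \<subseteq> {A}"
  proof
    fix e assume "e \<in> C"
    then have "A = e" using 0(3)[of e] by (intro card_seteq) auto
    then show "e \<in> {A}" by simp
  qed
  then have "card C \<le> card {A}" by (intro card_mono) auto
  then show ?case using 0(4) by simp
next
  case (Suc d)
  define good where "good Q \<longleftrightarrow> Q \<subseteq> C - {A} \<and> (\<forall>e\<in>Q. \<forall>e'\<in>Q. e \<noteq> e' \<longrightarrow> e \<inter> e' = A)" for Q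
  have "good {}" by (simp add: good_def)
  moreover have "\<forall>Q. good Q \<longrightarrow> card Q < Suc (card C)"
    unfolding less_Suc_eq_le using Suc.prems(1) by (auto simp: good_def intro!: card_mono)
  ultimately have "\<exists>Q. good Q \<and> (\<forall>Q'. good Q' \<longrightarrow> card Q' \<le> card Q)"
    by (rule ex_has_greatest_nat)
  then obtain Q where "good Q \<and> (\<forall>Q'. good Q' \<longrightarrow> card Q' \<le> card Q)" ..
  then have Q: "good Q" "\<And>Q'. good Q' \<Longrightarrow> card Q' \<le> card Q" by auto
  have finQ: "finite Q" using Q(1) Suc.prems(1) finite_subset by (auto simp: good_def)
  show ?case
  proof (cases "M \<le> card Q")
    case True
    then obtain Q' where Q': "Q' \<subseteq> Q" "card Q' = M" using obtain_subset_with_card_n by blast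
    have "A \<subset> e" if "e \<in> Q'" for e using that Q' Q(1) Suc.prems(3)[of e] by (auto simp: good_def)
    moreover have "\<forall>e\<in>Q'. \<forall>e'\<in>Q'. e \<noteq> e' \<longrightarrow> e \<inter> e' = A" "Q' \<subseteq> C"
      using Q(1) Q'(1) unfolding good_def by blast+
    ultimately show ?thesis using Q'(2) Suc.prems(2) by blast
  next
    case False
    define B where "B = \<Union>Q - A"
    have QC: "Q \<subseteq> C" using Q(1) by (auto simp: good_def)
    have finB: "finite B" using finQ QC Suc.prems(3) by (auto simp: B_def)
    have "B = (\<Union>e\<in>Q. e - A)" by (auto simp: B_def)
    then have "card B \<le> (\<Sum>e\<in>Q. card (e - A))" using card_UN_le[OF finQ, of "\<lambda>e. e - A"] by (simp only:)
    also have "\<dots> \<le> (\<Sum>e\<in>Q. Suc d)"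
    proof (rule sum_mono)
      fix e assume "e \<in> Q"
      then have "finite e \<and> A \<subseteq> e \<and> card e \<le> card A + Suc d" using QC Suc.prems(3) by blast
      then show "card (e - A) \<le> Suc d" by (auto simp: card_Diff_subset Suc.prems(2))
    qed
    also have "\<dots> = card Q * Suc d" by simp
    also have "\<dots> \<le> M * Suc d" using False by (intro mult_le_mono1) simp
    finally have cB: "card B \<le> M * Suc d" .
    have hit: "\<exists>u\<in>B. u \<in> e" if e: "e \<in> C - {A}" for e
    proof (cases "e \<in> Q")
      case True
      have "A \<subset> e" using e Suc.prems(3)[of e] by auto
      then show ?thesis using True by (auto simp: B_def)
    next
      case False
      then have "card (insert e Q) > card Q" using finQ by simp
      then have "\<not> good (insert e Q)" using Q(2)[of "insert e Q"] by linarith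
      then obtain e' where "e' \<in> Q" "e \<inter> e' \<noteq> A"
        using Q(1) e unfolding good_def by (auto simp: Int_commute)
      moreover have "A \<subseteq> e \<inter> e'" using e Suc.prems(3)[of e] Suc.prems(3)[of e'] QC \<open>e' \<in> Q\<close> by auto
      ultimately show ?thesis by (auto simp: B_def)
    qed
    have "\<exists>u\<in>B. card {e\<in>C. u \<in> e} > sunflower_bound M d"
    proof (rule ccontr)
      assume "\<not> ?thesis"
      then have le: "card {e\<in>C. u \<in> e} \<le> sunflower_bound M d" if "u \<in> B" for u
        using that by (meson not_le)
      have "C \<subseteq> {A} \<union> (\<Union>u\<in>B. {e\<in>C. u \<in> e})" using hit by blast
      then have "card C \<le> card ({A} \<union> (\<Union>u\<in>B. {e\<in>C. u \<in> e}))"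
        using Suc.prems(1) finB by (intro card_mono) auto
      also have "\<dots> \<le> card {A} + card (\<Union>u\<in>B. {e\<in>C. u \<in> e})" by (rule card_Un_le)
      also have "card (\<Union>u\<in>B. {e\<in>C. u \<in> e}) \<le> (\<Sum>u\<in>B. card {e\<in>C. u \<in> e})"
        using finB by (rule card_UN_le)
      also have "\<dots> \<le> (\<Sum>u\<in>B. sunflower_bound M d)" using le by (rule sum_mono)
      also have "\<dots> = card B * sunflower_bound M d" by simp
      also have "\<dots> \<le> M * Suc d * sunflower_bound M d" using cB by (rule mult_le_mono1)
      finally show False using Suc.prems(4) by simp
    qed
    then obtain u where u: "u \<in> B" "card {e\<in>C. u \<in> e} > sunflower_bound M d" by blast
    have uA: "u \<notin> A" using u(1) by (simp add: B_def)
    have "\<exists>A' Q. insert u A \<subseteq> A' \<and> finite A' \<and> Q \<subseteq> {e\<in>C. u \<in> e} \<and> card Q = M \<and>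
        (\<forall>e\<in>Q. A' \<subset> e) \<and> (\<forall>e\<in>Q. \<forall>e'\<in>Q. e \<noteq> e' \<longrightarrow> e \<inter> e' = A')"
    proof (rule Suc.IH)
      fix e assume "e \<in> {e\<in>C. u \<in> e}"
      then show "finite e \<and> insert u A \<subseteq> e \<and> card e \<le> card (insert u A) + d"
        using Suc.prems(2) Suc.prems(3)[of e] uA by simp
    qed (use Suc.prems u in auto)
    then obtain A' Q' where "insert u A \<subseteq> A'" "finite A'" "Q' \<subseteq> {e\<in>C. u \<in> e}" "card Q' = M"
      "\<forall>e\<in>Q'. A' \<subset> e" "\<forall>e\<in>Q'. \<forall>e'\<in>Q'. e \<noteq> e' \<longrightarrow> e \<inter> e' = A'" by (elim exE conjE)
    moreover from this have "A \<subseteq> A'" "Q' \<subseteq> C" by auto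
    ultimately show ?thesis by (intro exI[of _ A'] exI[of _ Q'] conjI)
  qed
qed

text \<open>Petals may themselves be kernels. Requiring two vertices keeps every set large enough to
  be an edge and still covers all sunflowers through a given pair.\<close>

inductive_set kernels :: "nat \<Rightarrow> 'a set set \<Rightarrow> 'a set set" for M :: nat and H :: "'a set set" where
  base: "e \<in> H \<Longrightarrow> e \<in> kernels M H"
| kernel: "finite A \<Longrightarrow> 2 \<le> card A \<Longrightarrow> card Q = M \<Longrightarrow>
    (\<And>e. e \<in> Q \<Longrightarrow> e \<in> kernels M H \<and> A \<subset> e) \<Longrightarrow>
    (\<And>e e'. e \<in> Q \<Longrightarrow> e' \<in> Q \<Longrightarrow> e \<noteq> e' \<Longrightarrow> e \<inter> e' = A) \<Longrightarrow> A \<in> kernels M H"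

text \<open>A kernel is strictly smaller than its petals, so a set of full size \<open>r\<close> can
  only be an original edge.\<close>

lemma kernels_size:
  assumes "e \<in> kernels M H" and H: "\<And>e. e \<in> H \<Longrightarrow> finite e \<and> card e = r" and "2 \<le> r" "0 < M"
  shows "finite e \<and> 2 \<le> card e \<and> card e \<le> r \<and> (card e = r \<longrightarrow> e \<in> H) \<and> e \<subseteq> \<Union>H"
  using assms(1)
proof induction
  case (base e)
  then show ?case using H[of e] \<open>2 \<le> r\<close> by auto
next
  case (kernel A Q)
  have "Q \<noteq> {}" using kernel.hyps \<open>0 < M\<close> by auto
  then obtain e where "e \<in> Q" by blast
  note e = kernel.IH[OF this]
  then have "card A < card e" by (intro psubset_card_mono) auto
  then show ?case using e kernel.hyps(1,2) by auto
qed

text \<open>A set smaller than \<open>r\<close> entered as a kernel. Its \<open>M\<close> petals are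
  disjoint outside it, so fewer than \<open>M\<close> vertices cannot hit all of them.\<close>

lemma kernels_petal:
  assumes "e \<in> kernels M H" and H: "\<And>e. e \<in> H \<Longrightarrow> finite e \<and> card e = r"
    and "card e < r" "finite B" "card B < M"
  shows "\<exists>e'\<in>kernels M H. e \<subset> e' \<and> (e' - e) \<inter> B = {}"
  using assms(1)
proof cases
  case base
  then show ?thesis using H[of e] \<open>card e < r\<close> by simp
next
  case (kernel Q)
  show ?thesis
  proof (rule ccontr)
    assume "\<not> ?thesis"
    then have "\<forall>e'\<in>Q. \<exists>b. b \<in> (e' - e) \<inter> B" using kernel(4) by blast
    then obtain b where b: "\<And>e'. e' \<in> Q \<Longrightarrow> b e' \<in> (e' - e) \<inter> B" by metis
    have "inj_on b Q"
    proof (rule inj_onI, rule ccontr)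
      fix x y assume xy: "x \<in> Q" "y \<in> Q" "b x = b y" "x \<noteq> y"
      then have "x \<inter> y = e" using kernel(5) by blast
      then show False using b[OF xy(1)] b[OF xy(2)] xy(3) by auto
    qed
    then have "card Q \<le> card B" using b \<open>finite B\<close> by (intro card_inj_on_le[of b]) auto
    then show False using kernel(3) \<open>card B < M\<close> by simp
  qed
qed

text \<open>A short edge of a cycle is replaced by a petal that avoids all other vertices of the
  cycle; this changes no intersection and lowers the total deficit from \<open>r\<close>. The cycle
  covers at most \<open>l * r < M\<close> vertices, so a free petal exists.\<close>

lemma cycle_free_kernels:
  assumes free: "cycle_free l H" and H: "\<And>e. e \<in> H \<Longrightarrow> finite e \<and> card e = r"
    and r: "2 \<le> r" and M: "l * r < M"
  shows "cycle_free l (kernels M H)"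
proof -
  have "\<exists>e'. cyclic_edges l e' \<and> (\<forall>a<l. e' a \<in> H)"
    if "cyclic_edges l e" "\<And>a. a < l \<Longrightarrow> e a \<in> kernels M H" for e
    using that
  proof (induction "\<Sum>a<l. r - card (e a)" arbitrary: e rule: less_induct)
    case less
    have K: "finite (e a) \<and> 2 \<le> card (e a) \<and> card (e a) \<le> r \<and> (card (e a) = r \<longrightarrow> e a \<in> H)"
      if "a < l" for a
      using kernels_size[OF less.prems(2)[OF that] H r] M by auto
    show ?case
    proof (cases "\<forall>a<l. card (e a) = r")
      case True
      then show ?thesis using K less.prems(1) by blast
    next
      case False
      then obtain a where a: "a < l" "card (e a) < r" using K by (meson le_neq_implies_less)
      define B where "B = (\<Union>b<l. e b)"
      have "card B \<le> (\<Sum>b<l. card (e b))" unfolding B_def by (rule card_UN_le) simp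
      also have "\<dots> \<le> (\<Sum>b<l. r)" using K by (intro sum_mono) auto
      finally have "card B < M" using M by simp
      moreover have "finite B" using K by (auto simp: B_def)
      ultimately have "\<exists>e'\<in>kernels M H. e a \<subset> e' \<and> (e' - e a) \<inter> B = {}"
        by (intro kernels_petal[OF less.prems(2)[OF a(1)] _ a(2)] H)
      then obtain e' where e': "e' \<in> kernels M H" "e a \<subset> e'" "(e' - e a) \<inter> B = {}" by blast
      define f where "f = e(a := e')"
      have int: "f b \<inter> f c = e b \<inter> e c" if "b < l" "c < l" "b \<noteq> c" for b c
      proof -
        have "e' \<inter> e d = e a \<inter> e d" if "d < l" "d \<noteq> a" for d
          using e'(2,3) that by (auto simp: B_def)
        then show ?thesis using that by (auto simp: f_def)
      qed
      have "cyclic_edges l f"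
        unfolding cyclic_edges_def
      proof (intro allI impI)
        fix b c assume bc: "b < c \<and> c < l"
        then have "f b \<inter> f c = e b \<inter> e c" by (intro int) auto
        then show "card (f b \<inter> f c) = (if c = Suc b \<or> b = 0 \<and> c = l - 1 then 1 else 0)"
          using less.prems(1) bc unfolding cyclic_edges_def by simp
      qed
      moreover have "f b \<in> kernels M H" if "b < l" for b
        using less.prems(2)[OF that] e'(1) by (simp add: f_def)
      moreover have "(\<Sum>b<l. r - card (f b)) < (\<Sum>b<l. r - card (e b))"
      proof (rule sum_strict_mono_ex1)
        have "finite e'" using kernels_size[OF e'(1) H r] M by auto
        then have "card (e a) < card e'" using e'(2) by (rule psubset_card_mono)
        then show "\<forall>b\<in>{..<l}. r - card (f b) \<le> r - card (e b)"
          "\<exists>b\<in>{..<l}. r - card (f b) < r - card (e b)"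
          using a by (auto simp: f_def intro!: bexI[of _ a])
      qed simp
      ultimately show ?thesis using less.hyps[of f] by blast
    qed
  qed
  then show ?thesis using free unfolding cycle_free_def by blast
qed

section \<open>Minimal sets of the closure\<close>

definition minimal_sets :: "'a set set \<Rightarrow> 'a set set" where
  "minimal_sets K = {e\<in>K. \<forall>e'\<in>K. e' \<subseteq> e \<longrightarrow> e' = e}"

lemma minimal_sets_below:
  assumes "e \<in> K" "finite e"
  shows "\<exists>e'\<in>minimal_sets K. e' \<subseteq> e"
  using assms
proof (induction "card e" arbitrary: e rule: less_induct)
  case less
  show ?case
  proof (cases "e \<in> minimal_sets K")
    case False
    then obtain e' where e': "e' \<in> K" "e' \<subset> e" using less.prems by (auto simp: minimal_sets_def)
    then have "\<exists>e''\<in>minimal_sets K. e'' \<subseteq> e'"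
      using less.prems psubset_card_mono[of e e'] finite_subset[of e' e] by (intro less.hyps) auto
    then show ?thesis using e' by blast
  qed auto
qed

text \<open>Too many minimal sets through a pair would contain a sunflower of \<open>M\<close> of
  them whose kernel includes that pair. The kernel then belongs to the closure and lies strictly
  below a minimal set.\<close>

lemma sparse_minimal_kernels:
  assumes "finite H" and H: "\<And>e. e \<in> H \<Longrightarrow> finite e \<and> card e = r" and r: "2 \<le> r" and M: "0 < M"
  shows "sparse_hypergraph (minimal_sets (kernels M H)) r (sunflower_bound M (r - 2))"
proof
  let ?K = "kernels M H"
  have size: "finite e \<and> 2 \<le> card e \<and> card e \<le> r \<and> e \<subseteq> \<Union>H" if "e \<in> ?K" for e
    using kernels_size[OF that H r M] by blast
  have "finite (\<Union>H)" using \<open>finite H\<close> H by blast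
  then have "finite ?K" using size by (intro finite_subset[of ?K "Pow (\<Union>H)"]) auto
  then show fin: "finite (minimal_sets ?K)" by (simp add: minimal_sets_def)
  show "finite e" "2 \<le> card e" "card e \<le> r" if "e \<in> minimal_sets ?K" for e
    using size[of e] that by (auto simp: minimal_sets_def)
  fix u v :: 'a assume uv: "u \<noteq> v"
  show "card {e\<in>minimal_sets ?K. u \<in> e \<and> v \<in> e} \<le> sunflower_bound M (r - 2)"
  proof (rule ccontr)
    assume "\<not> ?thesis"
    then have "card {e\<in>minimal_sets ?K. u \<in> e \<and> v \<in> e} > sunflower_bound M (r - 2)" by simp
    then have "\<exists>A' Q. {u, v} \<subseteq> A' \<and> finite A' \<and> Q \<subseteq> {e\<in>minimal_sets ?K. u \<in> e \<and> v \<in> e} \<and> card Q = M \<and>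
        (\<forall>e\<in>Q. A' \<subset> e) \<and> (\<forall>e\<in>Q. \<forall>e'\<in>Q. e \<noteq> e' \<longrightarrow> e \<inter> e' = A')"
    proof (intro sunflower_above[where A = "{u, v}" and d = "r - 2"])
      fix e assume "e \<in> {e\<in>minimal_sets ?K. u \<in> e \<and> v \<in> e}"
      then show "finite e \<and> {u, v} \<subseteq> e \<and> card e \<le> card {u, v} + (r - 2)"
        using size[of e] r uv by (auto simp: minimal_sets_def)
    qed (use fin in auto)
    then obtain A Q where A0: "{u, v} \<subseteq> A" "finite A" "Q \<subseteq> {e\<in>minimal_sets ?K. u \<in> e \<and> v \<in> e}"
      "card Q = M" "\<forall>e\<in>Q. A \<subset> e" "\<forall>e\<in>Q. \<forall>e'\<in>Q. e \<noteq> e' \<longrightarrow> e \<inter> e' = A" by (elim exE conjE)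
    have A3: "Q \<subseteq> minimal_sets ?K" using A0(3) by blast
    note A = A0(1,2) A3 A0(4) A0(5)[rule_format] A0(6)[rule_format]
    have "card A \<ge> 2" using card_mono[OF A(2,1)] uv by simp
    moreover have QK: "e \<in> ?K" if "e \<in> Q" for e using that A(3) by (auto simp: minimal_sets_def)
    ultimately have "A \<in> ?K" using A by (intro kernels.kernel[of A Q]) auto
    moreover obtain e where "e \<in> Q" using A(4) M by fastforce
    ultimately show False using A(3) A(5)[of e] by (auto simp: minimal_sets_def)
  qed
qed

lemma independent_minimal_kernels:
  assumes H: "\<And>e. e \<in> H \<Longrightarrow> finite e" and "independent (minimal_sets (kernels M H)) I"
  shows "independent H I"
  unfolding independent_def
proof (intro ballI notI)
  fix e assume e: "e \<in> H" "e \<subseteq> I"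
  then obtain e' where "e' \<in> minimal_sets (kernels M H)" "e' \<subseteq> e"
    using minimal_sets_below[OF kernels.base[OF e(1)] H] by blast
  then show False using e(2) assms(2) unfolding independent_def by (meson order_trans)
qed

section \<open>The Ramsey number\<close>

lemma cycle_free_mono: "cycle_free l H \<Longrightarrow> H' \<subseteq> H \<Longrightarrow> cycle_free l H'"
  unfolding cycle_free_def by blast

text \<open>The constants depend only on \<open>r\<close>, \<open>D\<close> and \<open>k\<close>, so
  they can be named before the colouring is known. \<open>M\<close> is one more than the number of
  vertices that a cycle of \<open>2 * k + 1\<close> edges can cover at most.\<close>

lemma red_cycle_or_blue_complete:
  fixes f :: "nat set \<Rightarrow> colour" and r k n q :: nat
  defines "M \<equiv> (2 * k + 1) * r + 1"
  defines "D \<equiv> sunflower_bound M (r - 2)"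
  defines "g \<equiv> sparse_hypergraph.growth_const r D" and "c \<equiv> sparse_hypergraph.level_const r D k"
  assumes r: "r \<ge> 2" and k: "k \<ge> 1"
    and q: "sparse_hypergraph.stage_const r D \<le> q" "g ^ k * (c * n) \<le> q ^ k" "q > 0"
  shows "has_red_cycle r (2 * k + 1) (c * q * n) f \<or> has_blue_complete r n (c * q * n) f"
proof -
  have M: "0 < M" "(2 * k + 1) * r < M" by (simp_all add: M_def)
  define l where "l = 2 * k + 1"
  define N where "N = c * q * n"
  define H where "H = {e\<in>nsets {..<N} r. f e = Red}"
  have H: "finite e \<and> card e = r" if "e \<in> H" for e using that by (auto simp: H_def nsets_def)
  have "finite (nsets {..<N} r)" by (simp add: finite_imp_finite_nsets)
  then have "finite H" by (simp add: H_def)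
  show ?thesis
  proof (cases "cycle_free l H")
    case False
    then obtain e where e: "cyclic_edges l e" "\<And>a. a < l \<Longrightarrow> e a \<in> H"
      by (auto simp: cycle_free_def)
    have "loose_cycle l (e ` {..<l})"
      using e(1)
    proof (rule cyclic_edges_imp_loose_cycle)
      show "3 \<le> l" using k by (simp add: l_def)
      show "finite (e a) \<and> 2 \<le> card (e a)" if "a < l" for a using H[OF e(2)[OF that]] r by simp
    qed
    moreover have "e ` {..<l} \<subseteq> H" using e(2) by auto
    ultimately have "has_red_cycle r l N f"
      unfolding has_red_cycle_def uniform_loose_cycle_def using H
      by (intro exI[of _ "e ` {..<l}"]) (auto simp: H_def)
    then show ?thesis by (simp add: N_def l_def)
  next
    case True
    define H' where "H' = minimal_sets (kernels M H)"
    interpret sparse_hypergraph H' r D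
      unfolding H'_def D_def using \<open>finite H\<close> H r M(1) by (rule sparse_minimal_kernels)
    have "cycle_free l (kernels M H)"
      using True H r M(2)[folded l_def] by (rule cycle_free_kernels)
    then have free: "cycle_free (2 * k + 1) H'"
      unfolding l_def by (rule cycle_free_mono) (auto simp: H'_def minimal_sets_def)
    have "0 < r" using r by simp
    obtain I where I: "I \<subseteq> {..<N}" "independent H' I" "n \<le> card I \<or> card {..<N} \<le> c * q * card I"
      using large_independent_set[OF finite_lessThan \<open>0 < r\<close> free q[unfolded g_def c_def]]
      unfolding c_def by blast
    have "c > 0" unfolding c_def level_const_def by simp
    \<comment> \<open>The choice \<open>N = c * q * n\<close> makes the second alternative also give
      \<open>n \<le> card I\<close>.\<close>
    then have "n \<le> card I" using I(3) \<open>q > 0\<close> by (auto simp: N_def)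
    then obtain S where S: "S \<subseteq> I" "card S = n" by (meson obtain_subset_with_card_n)
    have ind: "independent H I"
      by (rule independent_minimal_kernels[OF _ I(2)[unfolded H'_def]]) (simp add: H)
    have "f e = Blue" if "e \<in> nsets S r" for e
    proof (rule ccontr)
      assume "f e \<noteq> Blue"
      then have "f e = Red" by (cases "f e") auto
      then have "e \<in> H" using that S(1) I(1) by (auto simp: H_def nsets_def)
      then show False using ind that S(1) by (auto simp: independent_def nsets_def)
    qed
    then have "has_blue_complete r n N f"
      unfolding has_blue_complete_def using S I(1) by blast
    then show ?thesis by (simp add: N_def)
  qed
qed

lemma ramsey_cycle_complete_le:
  assumes "\<And>f. has_red_cycle r l N f \<or> has_blue_complete r n N f"
  shows "ramsey_cycle_complete r l n \<le> N"
  unfolding ramsey_cycle_complete_def using assms by (intro Least_le) blast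

theorem theorem1p6:
  fixes r l :: nat
  assumes "r \<ge> 3" and "l \<ge> 5" and "odd l"
  shows "\<exists>c::real. c > 0 \<and>
    (\<forall>n::nat. real (ramsey_cycle_complete r l n)
      \<le> c * real n powr (1 + 1 / real_of_int \<lfloor>real l / 2\<rfloor>))"
proof -
  obtain k where k: "l = 2 * k + 1" using \<open>odd l\<close> by (rule oddE)
  then have k1: "k \<ge> 1" using \<open>l \<ge> 5\<close> by simp
  have fl: "real_of_int \<lfloor>real l / 2\<rfloor> = real k"
  proof -
    have "\<lfloor>real l / 2\<rfloor> = int k" unfolding k by (intro floor_unique) (auto simp: field_simps)
    then show ?thesis by simp
  qed
  define D where "D = sunflower_bound ((2 * k + 1) * r + 1) (r - 2)"
  define g where "g = sparse_hypergraph.growth_const r D"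
  define c where "c = sparse_hypergraph.level_const r D k"
  define s where "s = sparse_hypergraph.stage_const r D"
  \<comment> \<open>The empty hypergraph serves only to unfold the constants, which do not depend on
    the edges.\<close>
  have "sparse_hypergraph {} r D" by standard auto
  then interpret sparse_hypergraph "{} :: nat set set" r D .
  have pos: "g > 0" "c > 0" "s > 0"
    by (simp_all add: g_def c_def s_def growth_const_def level_const_def stage_const_def)
  \<comment> \<open>With \<open>q = A * t\<close> the factor \<open>s\<close> gives
    \<open>s \<le> q\<close>, while \<open>g\<close> and \<open>c\<close> give
    \<open>g ^ k * (c * n) \<le> q ^ k\<close>, using \<open>c \<le> c ^ k\<close>.\<close>
  define A where "A = g * c * s"
  have A: "A > 0" "A \<ge> s" using pos by (auto simp: A_def)
  define B where "B = 2 * real (c * A)"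
  have "real (ramsey_cycle_complete r l n) \<le> B * real n powr (1 + 1 / real k)" for n
  proof (cases "n = 0")
    case True
    \<comment> \<open>On no vertices the empty set is already blue complete, so the Ramsey number is
      0, which agrees with \<open>0 powr _ = 0\<close>.\<close>
    have "has_blue_complete r 0 0 f" for f
      unfolding has_blue_complete_def using \<open>r \<ge> 3\<close> by (auto simp: nsets_def)
    then have "ramsey_cycle_complete r l 0 \<le> 0" by (intro ramsey_cycle_complete_le) simp
    then show ?thesis using True by simp
  next
    case False
    define x where "x = real n powr (1 / real k)"
    have x1: "x \<ge> 1" using False by (simp add: x_def ge_one_powr_ge_zero)
    \<comment> \<open>Rounding up at most doubles \<open>x\<close>, since \<open>x \<ge> 1\<close>;
      this is the factor 2 in \<open>B\<close>.\<close>
    define t where "t = nat \<lceil>x\<rceil>"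
    have t: "x \<le> real t" "real t \<le> 2 * x" "t \<ge> 1" using x1 unfolding t_def by linarith+
    have "real n = x ^ k"
      using False k1 by (simp add: x_def powr_realpow[symmetric] powr_powr)
    also have "\<dots> \<le> real t ^ k" using t(1) x1 by (intro power_mono) auto
    finally have tn: "n \<le> t ^ k" by (metis of_nat_le_iff of_nat_power)
    define q where "q = A * t"
    have "c \<le> c ^ k" using k1 pos by (metis One_nat_def Suc_leI power_increasing power_one_right)
    moreover have "1 \<le> s ^ k" using pos by simp
    ultimately have "g ^ k * (c * n) \<le> g ^ k * (c ^ k * s ^ k * t ^ k)"
      using tn by (intro mult_le_mono2 mult_le_mono) (metis mult.right_neutral mult_le_mono)
    also have "\<dots> = q ^ k" by (simp add: q_def A_def power_mult_distrib)
    finally have "g ^ k * (c * n) \<le> q ^ k" .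
    moreover have "s \<le> q" using mult_le_mono[OF A(2) t(3)] by (simp add: q_def)
    moreover have "0 < q" using A t(3) by (simp add: q_def)
    ultimately have "has_red_cycle r l (c * q * n) f \<or> has_blue_complete r n (c * q * n) f" for f
      unfolding k c_def g_def s_def D_def using \<open>r \<ge> 3\<close> k1
      by (intro red_cycle_or_blue_complete) auto
    then have "ramsey_cycle_complete r l n \<le> c * q * n" by (rule ramsey_cycle_complete_le)
    then have "real (ramsey_cycle_complete r l n) \<le> real (c * q * n)" by (simp only: of_nat_le_iff)
    also have "\<dots> = real (c * A) * real n * real t" by (simp add: q_def)
    also have "\<dots> \<le> real (c * A) * real n * (2 * x)" using t(2) by (intro mult_left_mono) auto
    also have "\<dots> = B * real n powr (1 + 1 / real k)"
      using False by (simp add: B_def x_def powr_add)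
    finally show ?thesis .
  qed
  moreover have "B > 0" using A pos by (simp add: B_def)
  ultimately show ?thesis unfolding fl by blast
qed

end
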